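(* Let $N\in\mathbb{N}$, let $y_r\in X_N$, and let $y^\star\in X_N$ be any solution of the fixed-point equation $y^\star+T_Ny^\star=y_r$ in $X_N$, where $T_Ny:=P_N\mathcal Z_N(y)$. Let $y_\infty(y^\star):=y^\star+\mathcal Z_N(y^\star)\in V'$ (all objects defined in the context). Then $$P_Ny_\infty(y^\star)=y_r,$$ and $$y_\infty(y^\star)-y_r=(I-P_N)\,y_\infty(y^\star)=(I-P_N)\,\mathcal Z_N(y^\star).$$ In particular, $$\|y_\infty(y^\star)-y_r\|_{V'}\le\|I-P_N\|\,C_{\mathrm{cl}}\,\|(I-P_N)B\|_{\mathcal L(\mathbb{R}^M,D(\mathcal A)')}\,\|U_N\|\,\|y^\star\|_{X_N}.$$ If $I+T_N$ is invertible, so that $y^\star=(I+T_N)^{-1}y_r$, then $$\|y_\infty(y^\star)-y_r\|_{V'}\le\|I-P_N\|\,C_{\mathrm{cl}}\,\|(I-P_N)B\|_{\mathcal L(\mathbb{R}^M,D(\mathcal A)')}\,\|U_N\|\,\|(I+T_N)^{-1}\|\,\|y_r\|_{X_N}.$$ Moreover, if $\|T_N\|_{\mathcal L(X_N)}<1$, then $\|(I+T_N)^{-1}\|\le(1-\|T_N\|)^{-1}$.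
   Context: $\Omega\subset\mathbb{R}^3$ is a bounded connected $C^2$ domain, $\kappa_m>0$, $H=L^2(\Omega)$; $A_0=\kappa_m\Delta$ with $D(A_0)=\{y\in H^2(\Omega):\partial_\nu y=0\}$; $\mathcal A=I-A_0$, $D(\mathcal A)=D(A_0)$ with $\|w\|_{D(\mathcal A)}=\|\mathcal Aw\|_H$; $V=H^1(\Omega)$ with $\|w\|_V^2=\|w\|_H^2+\kappa_m\|\nabla w\|^2_{L^2}$; with $H$ as pivot, $D(\mathcal A)\subset V\subset H\subset V'\subset D(\mathcal A)'$, and $A_0$, $\mathcal A^{-1}$ are extended by duality to $H\to D(\mathcal A)'$ and $D(\mathcal A)'\to H$. $\{\varphi_k\}_{k\ge1}$ is an $L^2$-orthonormal basis of eigenfunctions of $-A_0$ (increasing eigenvalues); $X_N=\mathrm{span}\{\varphi_1,\dots,\varphi_N\}$ with a fixed norm $\|\cdot\|_{X_N}$; $P_N\eta:=\sum_{k=1}^N\langle\eta,\varphi_k\rangle\varphi_k$ for $\eta\in D(\mathcal A)'$ (in particular on $V'$). Actuators: points $x_1,\dots,x_M\in\Omega$, $Bu=\sum_{j=1}^Mu_j\delta_{x_j}\in D(\mathcal A)'$ for $u\in\mathbb{R}^M$; the $N\times M$ matrix $(\varphi_k(x_j))$ has full row rank. $U_N:X_N\to\mathbb{R}^M$ is a fixed linear map such that $u=U_Ny^\star$ solves $\sum_ju_j\varphi_k(x_j)=-\langle A_0y^\star,\varphi_k\rangle_H$, $k=1,\dots,N$ (e.g. the minimum-norm solution). $g(y^\star):=A_0y^\star+BU_Ny^\star\in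 D(\mathcal A)'$, so that $g(y^\star)=(I-P_N)BU_Ny^\star$. Closed loop: the points and the gain $\lambda>0$ are such that $\dot z=A_0z-\lambda\sum_{j=1}^M(\mathcal A^{-1}z)(x_j)\,\delta_{x_j}$ generates an exponentially stable semigroup $\mathcal S_{\mathrm{cl}}(t)$ on $V'$ (applied to $D(\mathcal A)'$ by its natural extension); $\mathcal R_{\mathrm{cl}}h:=\int_0^\infty\mathcal S_{\mathrm{cl}}(s)h\,ds$ is a bounded operator $D(\mathcal A)'\to V'$ and $C_{\mathrm{cl}}>0$ is any constant with $\|\mathcal R_{\mathrm{cl}}h\|_{V'}\le C_{\mathrm{cl}}\|h\|_{D(\mathcal A)'}$ for all $h$. The bias map is $\mathcal Z_N(y^\star):=\mathcal R_{\mathrm{cl}}\,g(y^\star)$. Norms: $\|I-P_N\|$ is the operator norm on $V'$; $\|U_N\|$ is the norm in $\mathcal L(X_N,\mathbb{R}^M)$; $\|T_N\|$ and $\|(I+T_N)^{-1}\|$ are norms in $\mathcal L(X_N)$. *)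

theory Defs
  imports "HOL-Analysis.Analysis" "HOL-Library.Function_Algebras"
begin

text \<open>
  Elements of \<open>L\<^sup>2(\<Omega>)\<close>, \<open>H\<^sup>1(\<Omega>)\<close>, \<open>D(\<A>)\<close> are represented by functions on \<open>\<real>\<^sup>3\<close>, of which only the
  almost-everywhere class on \<open>\<Omega>\<close> matters. Elements of \<open>V'\<close> and \<open>D(\<A>)'\<close> are bounded linear
  functionals on the carriers \<open>V\<close> and \<open>D(\<A>)\<close>, set to 0 off the carrier, so that HOL equality is
  equality of functionals; boundedness makes them independent of the chosen representatives.
  The duality pairing \<open>\<langle>\<eta>, w\<rangle>\<close> is the application \<open>\<eta> w\<close>.
\<close>

type_synonym pt = "real^3"
type_synonym fld = "pt \<Rightarrow> real"
type_synonym fctl = "fld \<Rightarrow> real"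


subsection \<open>Normed spaces given by carriers\<close>

definition is_norm_on :: "('a \<Rightarrow> real) set \<Rightarrow> (('a \<Rightarrow> real) \<Rightarrow> real) \<Rightarrow> bool" where
  "is_norm_on X n \<longleftrightarrow>
     (\<forall>u\<in>X. 0 \<le> n u \<and> (n u = 0 \<longleftrightarrow> u = (\<lambda>a. 0))) \<and>
     (\<forall>u\<in>X. \<forall>v\<in>X. n (u + v) \<le> n u + n v) \<and>
     (\<forall>u\<in>X. \<forall>c. n (\<lambda>a. c * u a) = \<bar>c\<bar> * n u)"

text \<open>The operator norm, as in the library's \<^const>\<open>onorm\<close> (with \<open>0 / 0 = 0\<close>).\<close>

definition opnorm :: "'a set \<Rightarrow> ('a \<Rightarrow> real) \<Rightarrow> ('b \<Rightarrow> real) \<Rightarrow> ('a \<Rightarrow> 'b) \<Rightarrow> real" where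
  "opnorm X nX nY T = (SUP x\<in>X. nY (T x) / nX x)"

definition dual :: "('a \<Rightarrow> real) set \<Rightarrow> (('a \<Rightarrow> real) \<Rightarrow> real) \<Rightarrow> (('a \<Rightarrow> real) \<Rightarrow> real) set" where
  "dual X n = {F. (\<forall>u\<in>X. \<forall>v\<in>X. F (u + v) = F u + F v) \<and>
                  (\<forall>u\<in>X. \<forall>c. F (\<lambda>a. c * u a) = c * F u) \<and>
                  (\<exists>C. \<forall>u\<in>X. \<bar>F u\<bar> \<le> C * n u) \<and>
                  (\<forall>u. u \<notin> X \<longrightarrow> F u = 0)}"

definition dual_norm :: "('a \<Rightarrow> real) set \<Rightarrow> (('a \<Rightarrow> real) \<Rightarrow> real) \<Rightarrow> (('a \<Rightarrow> real) \<Rightarrow> real) \<Rightarrow> real" where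
  "dual_norm X n F = opnorm X n abs F"

definition bounded_operator ::
  "('a \<Rightarrow> real) set \<Rightarrow> (('a \<Rightarrow> real) \<Rightarrow> real) \<Rightarrow> ('b \<Rightarrow> real) set \<Rightarrow> (('b \<Rightarrow> real) \<Rightarrow> real) \<Rightarrow>
   (('a \<Rightarrow> real) \<Rightarrow> ('b \<Rightarrow> real)) \<Rightarrow> bool" where
  "bounded_operator X nX Y nY T \<longleftrightarrow>
     (\<forall>u\<in>X. T u \<in> Y) \<and>
     (\<forall>u\<in>X. \<forall>v\<in>X. T (u + v) = T u + T v) \<and>
     (\<forall>u\<in>X. \<forall>c. T (\<lambda>a. c * u a) = (\<lambda>b. c * T u b)) \<and>
     (\<exists>C. \<forall>u\<in>X. nY (T u) \<le> C * nX u)"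

definition c0_semigroup ::
  "('a \<Rightarrow> real) set \<Rightarrow> (('a \<Rightarrow> real) \<Rightarrow> real) \<Rightarrow> (real \<Rightarrow> ('a \<Rightarrow> real) \<Rightarrow> ('a \<Rightarrow> real)) \<Rightarrow> bool" where
  "c0_semigroup X n S \<longleftrightarrow>
     (\<forall>t\<ge>0. bounded_operator X n X n (S t)) \<and>
     (\<forall>z\<in>X. S 0 z = z) \<and>
     (\<forall>s\<ge>0. \<forall>t\<ge>0. \<forall>z\<in>X. S (s + t) z = S s (S t z)) \<and>
     (\<forall>z\<in>X. ((\<lambda>t. n (S t z - z)) \<longlongrightarrow> 0) (at_right 0))"

definition exponentially_stable ::
  "('a \<Rightarrow> real) set \<Rightarrow> (('a \<Rightarrow> real) \<Rightarrow> real) \<Rightarrow> (real \<Rightarrow> ('a \<Rightarrow> real) \<Rightarrow> ('a \<Rightarrow> real)) \<Rightarrow> bool" where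
  "exponentially_stable X n S \<longleftrightarrow>
     (\<exists>K \<omega>. \<omega> > 0 \<and> (\<forall>t\<ge>0. \<forall>z\<in>X. n (S t z) \<le> K * exp (- \<omega> * t) * n z))"

text \<open>\<open>Gr\<close> is the graph of the infinitesimal generator, including its exact domain.\<close>

definition has_generator ::
  "('a \<Rightarrow> real) set \<Rightarrow> (('a \<Rightarrow> real) \<Rightarrow> real) \<Rightarrow> (real \<Rightarrow> ('a \<Rightarrow> real) \<Rightarrow> ('a \<Rightarrow> real)) \<Rightarrow>
   (('a \<Rightarrow> real) \<times> ('a \<Rightarrow> real)) set \<Rightarrow> bool" where
  "has_generator X n S Gr \<longleftrightarrow>
     Gr = {(z, v). z \<in> X \<and> v \<in> X \<and>
                   ((\<lambda>t. n (\<lambda>a. (S t z a - z a) / t - v a)) \<longlongrightarrow> 0) (at_right 0)}"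


subsection \<open>Domains of class \<open>C\<^sup>2\<close>\<close>

definition C1_grad_on :: "pt set \<Rightarrow> fld \<Rightarrow> (pt \<Rightarrow> pt) \<Rightarrow> bool" where
  "C1_grad_on U f g \<longleftrightarrow> (\<forall>x\<in>U. GDERIV f x :> g x) \<and> continuous_on U g"

definition C2_grad_on :: "pt set \<Rightarrow> fld \<Rightarrow> (pt \<Rightarrow> pt) \<Rightarrow> bool" where
  "C2_grad_on U f g \<longleftrightarrow> C1_grad_on U f g \<and> (\<forall>i. \<exists>h. C1_grad_on U (\<lambda>x. g x $ i) h)"

text \<open>The boundary condition is the local defining-function form of a \<open>C\<^sup>2\<close> boundary: near each
  boundary point, \<open>\<Omega>\<close> is the negativity set of a \<open>C\<^sup>2\<close> function without critical points.\<close>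

definition bounded_C2_domain :: "pt set \<Rightarrow> bool" where
  "bounded_C2_domain \<Omega> \<longleftrightarrow>
     open \<Omega> \<and> connected \<Omega> \<and> bounded \<Omega> \<and> \<Omega> \<noteq> {} \<and>
     (\<forall>p\<in>frontier \<Omega>. \<exists>U \<rho> g. open U \<and> p \<in> U \<and> C2_grad_on U \<rho> g \<and> (\<forall>x\<in>U. g x \<noteq> 0) \<and>
        \<Omega> \<inter> U = {x\<in>U. \<rho> x < 0})"


subsection \<open>Lebesgue and Sobolev spaces\<close>

definition L2 :: "pt set \<Rightarrow> fld set" where
  "L2 \<Omega> = {u. u \<in> borel_measurable (lebesgue_on \<Omega>) \<and> integrable (lebesgue_on \<Omega>) (\<lambda>x. (u x)\<^sup>2)}"

definition ipH :: "pt set \<Rightarrow> fld \<Rightarrow> fld \<Rightarrow> real" where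
  "ipH \<Omega> u v = (\<integral>x. u x * v x \<partial>lebesgue_on \<Omega>)"

definition normH :: "pt set \<Rightarrow> fld \<Rightarrow> real" where
  "normH \<Omega> u = sqrt (ipH \<Omega> u u)"

text \<open>\<open>f\<close> is \<open>C\<^sup>\<infinity>\<close> iff it lies in a family of differentiable functions closed under partial
  derivatives.\<close>

definition smooth :: "fld \<Rightarrow> bool" where
  "smooth f \<longleftrightarrow> (\<exists>G. f \<in> G \<and>
     (\<forall>g\<in>G. \<exists>d. (\<forall>x. GDERIV g x :> d x) \<and> (\<forall>i. (\<lambda>x. d x $ i) \<in> G)))"

definition test_fun :: "pt set \<Rightarrow> fld \<Rightarrow> bool" where
  "test_fun \<Omega> \<psi> \<longleftrightarrow> smooth \<psi> \<and> (\<exists>K. compact K \<and> K \<subseteq> \<Omega> \<and> (\<forall>x. x \<notin> K \<longrightarrow> \<psi> x = 0))"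

definition weak_grad :: "pt set \<Rightarrow> fld \<Rightarrow> (pt \<Rightarrow> pt) \<Rightarrow> bool" where
  "weak_grad \<Omega> u g \<longleftrightarrow>
     (\<forall>i. (\<lambda>x. g x $ i) \<in> L2 \<Omega>) \<and>
     (\<forall>\<psi>. test_fun \<Omega> \<psi> \<longrightarrow>
        (\<forall>i. ipH \<Omega> u (\<lambda>x. frechet_derivative \<psi> (at x) (axis i 1)) = - ipH \<Omega> (\<lambda>x. g x $ i) \<psi>))"

definition H1 :: "pt set \<Rightarrow> fld set" where
  "H1 \<Omega> = {u \<in> L2 \<Omega>. \<exists>g. weak_grad \<Omega> u g}"

text \<open>A representative of the weak gradient, which is unique up to null sets.\<close>

definition wgrad :: "pt set \<Rightarrow> fld \<Rightarrow> pt \<Rightarrow> pt" where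
  "wgrad \<Omega> u = (SOME g. weak_grad \<Omega> u g)"

definition H2 :: "pt set \<Rightarrow> fld set" where
  "H2 \<Omega> = {u \<in> H1 \<Omega>. \<forall>i. (\<lambda>x. wgrad \<Omega> u x $ i) \<in> H1 \<Omega>}"

definition wlap :: "pt set \<Rightarrow> fld \<Rightarrow> fld" where
  "wlap \<Omega> u = (\<lambda>x. \<Sum>i\<in>UNIV. wgrad \<Omega> (\<lambda>y. wgrad \<Omega> u y $ i) x $ i)"

definition normV :: "pt set \<Rightarrow> real \<Rightarrow> fld \<Rightarrow> real" where
  "normV \<Omega> \<kappa> u = sqrt ((normH \<Omega> u)\<^sup>2 + \<kappa> * (\<integral>x. (norm (wgrad \<Omega> u x))\<^sup>2 \<partial>lebesgue_on \<Omega>))"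

text \<open>The normal derivative \<open>\<partial>\<^sub>\<nu>u\<close> of \<open>u \<in> H\<^sup>2(\<Omega>)\<close> as an element of \<open>H\<^sup>-\<^sup>1\<^sup>/\<^sup>2(\<partial>\<Omega>)\<close>, tested against the traces
  of \<open>v \<in> H\<^sup>1(\<Omega>)\<close>: by Green's formula, \<open>\<integral>\<^sub>\<partial>\<^sub>\<Omega> \<partial>\<^sub>\<nu>u v = \<integral>\<^sub>\<Omega> \<Delta>u v + \<nabla>u \<bullet> \<nabla>v\<close>.\<close>

definition normal_deriv :: "pt set \<Rightarrow> fld \<Rightarrow> fctl" where
  "normal_deriv \<Omega> u v =
     (\<integral>x. wlap \<Omega> u x * v x + wgrad \<Omega> u x \<bullet> wgrad \<Omega> v x \<partial>lebesgue_on \<Omega>)"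

definition DA :: "pt set \<Rightarrow> fld set" where
  "DA \<Omega> = {u \<in> H2 \<Omega>. \<forall>v\<in>H1 \<Omega>. normal_deriv \<Omega> u v = 0}"

definition A0 :: "pt set \<Rightarrow> real \<Rightarrow> fld \<Rightarrow> fld" where
  "A0 \<Omega> \<kappa> u = (\<lambda>x. \<kappa> * wlap \<Omega> u x)"

definition opA :: "pt set \<Rightarrow> real \<Rightarrow> fld \<Rightarrow> fld" where
  "opA \<Omega> \<kappa> u = (\<lambda>x. u x - A0 \<Omega> \<kappa> u x)"

definition normDA :: "pt set \<Rightarrow> real \<Rightarrow> fld \<Rightarrow> real" where
  "normDA \<Omega> \<kappa> w = normH \<Omega> (opA \<Omega> \<kappa> w)"


subsection \<open>Dual spaces and extensions by duality\<close>

definition Vd :: "pt set \<Rightarrow> real \<Rightarrow> fctl set" where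
  "Vd \<Omega> \<kappa> = dual (H1 \<Omega>) (normV \<Omega> \<kappa>)"

definition normVd :: "pt set \<Rightarrow> real \<Rightarrow> fctl \<Rightarrow> real" where
  "normVd \<Omega> \<kappa> = dual_norm (H1 \<Omega>) (normV \<Omega> \<kappa>)"

definition DAd :: "pt set \<Rightarrow> real \<Rightarrow> fctl set" where
  "DAd \<Omega> \<kappa> = dual (DA \<Omega>) (normDA \<Omega> \<kappa>)"

definition normDAd :: "pt set \<Rightarrow> real \<Rightarrow> fctl \<Rightarrow> real" where
  "normDAd \<Omega> \<kappa> = dual_norm (DA \<Omega>) (normDA \<Omega> \<kappa>)"

text \<open>\<open>emb X\<close> is the pivot inclusion \<open>H \<subset> X'\<close> for \<open>X = V, D(\<A>)\<close>; \<open>restr (DA \<Omega>)\<close> is the inclusion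
  \<open>V' \<subset> D(\<A>)'\<close>.\<close>

definition restr :: "fld set \<Rightarrow> fctl \<Rightarrow> fctl" where
  "restr X F = (\<lambda>w. if w \<in> X then F w else 0)"

definition emb :: "pt set \<Rightarrow> fld set \<Rightarrow> fld \<Rightarrow> fctl" where
  "emb \<Omega> X y = restr X (ipH \<Omega> y)"

definition A0_ext :: "pt set \<Rightarrow> real \<Rightarrow> fld \<Rightarrow> fctl" where
  "A0_ext \<Omega> \<kappa> y = restr (DA \<Omega>) (\<lambda>w. ipH \<Omega> y (A0 \<Omega> \<kappa> w))"

definition opA_inv :: "pt set \<Rightarrow> real \<Rightarrow> fctl \<Rightarrow> fld" where
  "opA_inv \<Omega> \<kappa> \<eta> = (SOME y. y \<in> L2 \<Omega> \<and> (\<forall>w\<in>DA \<Omega>. ipH \<Omega> y (opA \<Omega> \<kappa> w) = \<eta> w))"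

text \<open>The value at \<open>p \<in> \<Omega>\<close> of the continuous representative, as used for \<open>D(\<A>) \<subset> H\<^sup>2(\<Omega>) \<subset> C(\<Omega>)\<close>
  in dimension three.\<close>

definition cont_rep :: "pt set \<Rightarrow> fld \<Rightarrow> fld" where
  "cont_rep \<Omega> u = (SOME v. continuous_on \<Omega> v \<and> (AE x in lebesgue_on \<Omega>. u x = v x))"

definition pt_val :: "pt set \<Rightarrow> fld \<Rightarrow> pt \<Rightarrow> real" where
  "pt_val \<Omega> u p = cont_rep \<Omega> u p"

definition dirac :: "pt set \<Rightarrow> pt \<Rightarrow> fctl" where
  "dirac \<Omega> p = restr (DA \<Omega>) (\<lambda>w. pt_val \<Omega> w p)"


subsection \<open>Eigenfunctions and spectral truncation\<close>

text \<open>The sequences are indexed by \<open>k \<ge> 1\<close>; the entry at \<open>0\<close> is irrelevant.\<close>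

definition eigenbasis :: "pt set \<Rightarrow> real \<Rightarrow> (nat \<Rightarrow> fld) \<Rightarrow> (nat \<Rightarrow> real) \<Rightarrow> bool" where
  "eigenbasis \<Omega> \<kappa> \<phi> \<mu> \<longleftrightarrow>
     (\<forall>k\<ge>1. \<phi> k \<in> DA \<Omega> \<and> (AE x in lebesgue_on \<Omega>. - A0 \<Omega> \<kappa> (\<phi> k) x = \<mu> k * \<phi> k x)) \<and>
     (\<forall>k\<ge>1. \<mu> k \<le> \<mu> (Suc k)) \<and>
     (\<forall>k\<ge>1. \<forall>l\<ge>1. ipH \<Omega> (\<phi> k) (\<phi> l) = (if k = l then 1 else 0)) \<and>
     (\<forall>f\<in>L2 \<Omega>. (\<lambda>n. normH \<Omega> (\<lambda>x. f x - (\<Sum>k=1..n. ipH \<Omega> f (\<phi> k) * \<phi> k x))) \<longlonglongrightarrow> 0)"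

definition XN :: "(nat \<Rightarrow> fld) \<Rightarrow> nat \<Rightarrow> fld set" where
  "XN \<phi> N = {y. \<exists>c. y = (\<lambda>x. \<Sum>k=1..N. c k * \<phi> k x)}"

definition PN :: "(nat \<Rightarrow> fld) \<Rightarrow> nat \<Rightarrow> fctl \<Rightarrow> fld" where
  "PN \<phi> N \<eta> = (\<lambda>x. \<Sum>k=1..N. \<eta> (\<phi> k) * \<phi> k x)"

text \<open>\<open>I - P\<^sub>N\<close> on \<open>X'\<close>, for \<open>X = V\<close> or \<open>X = D(\<A>)\<close>.\<close>

definition IPN :: "pt set \<Rightarrow> fld set \<Rightarrow> (nat \<Rightarrow> fld) \<Rightarrow> nat \<Rightarrow> fctl \<Rightarrow> fctl" where
  "IPN \<Omega> X \<phi> N \<eta> = \<eta> - emb \<Omega> X (PN \<phi> N \<eta>)"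


subsection \<open>Actuators, bias and closed loop\<close>

definition opB :: "pt set \<Rightarrow> ('m::finite \<Rightarrow> pt) \<Rightarrow> real^'m \<Rightarrow> fctl" where
  "opB \<Omega> p u = (\<lambda>w. \<Sum>j\<in>UNIV. u $ j * dirac \<Omega> (p j) w)"

definition full_row_rank :: "pt set \<Rightarrow> (nat \<Rightarrow> fld) \<Rightarrow> nat \<Rightarrow> ('m::finite \<Rightarrow> pt) \<Rightarrow> bool" where
  "full_row_rank \<Omega> \<phi> N p \<longleftrightarrow>
     dim ((\<lambda>k. (\<chi> j. pt_val \<Omega> (\<phi> k) (p j)) :: real^'m) ` {1..N}) = N"

definition low_mode_feedforward ::
  "pt set \<Rightarrow> real \<Rightarrow> (nat \<Rightarrow> fld) \<Rightarrow> nat \<Rightarrow> ('m::finite \<Rightarrow> pt) \<Rightarrow> (fld \<Rightarrow> real^'m) \<Rightarrow> bool" where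
  "low_mode_feedforward \<Omega> \<kappa> \<phi> N p U \<longleftrightarrow>
     (\<forall>y\<in>XN \<phi> N. \<forall>z\<in>XN \<phi> N. U (y + z) = U y + U z) \<and>
     (\<forall>y\<in>XN \<phi> N. \<forall>c. U (\<lambda>x. c * y x) = c *\<^sub>R U y) \<and>
     (\<forall>y\<in>XN \<phi> N. \<forall>k\<in>{1..N}.
        (\<Sum>j\<in>UNIV. U y $ j * pt_val \<Omega> (\<phi> k) (p j)) = - ipH \<Omega> (A0 \<Omega> \<kappa> y) (\<phi> k))"

definition residual ::
  "pt set \<Rightarrow> real \<Rightarrow> ('m::finite \<Rightarrow> pt) \<Rightarrow> (fld \<Rightarrow> real^'m) \<Rightarrow> fld \<Rightarrow> fctl" where
  "residual \<Omega> \<kappa> p U y = A0_ext \<Omega> \<kappa> y + opB \<Omega> p (U y)"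

text \<open>The closed-loop operator maps \<open>H\<close> to \<open>D(\<A>)'\<close>. Its part in \<open>V'\<close> is the generator: for \<open>z \<in> V'\<close>
  with \<open>A\<^sub>0 z - \<lambda> \<Sum>\<^sub>j c\<^sub>j \<delta>\<^sub>x\<^sub>j \<in> V'\<close> one has \<open>\<A> z \<in> D(\<A>)'\<close>, hence \<open>z \<in> H\<close> and \<open>\<A>\<^sup>-\<^sup>1 z \<in> D(\<A>)\<close>, so the point
  values of \<open>\<A>\<^sup>-\<^sup>1 z\<close> make sense exactly there.\<close>

definition closed_loop_op ::
  "pt set \<Rightarrow> real \<Rightarrow> ('m::finite \<Rightarrow> pt) \<Rightarrow> real \<Rightarrow> fld \<Rightarrow> fctl" where
  "closed_loop_op \<Omega> \<kappa> p lam y =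
     A0_ext \<Omega> \<kappa> y - (\<lambda>w. lam * (\<Sum>j\<in>UNIV. pt_val \<Omega> (opA_inv \<Omega> \<kappa> (emb \<Omega> (DA \<Omega>) y)) (p j) * dirac \<Omega> (p j) w))"

definition closed_loop_graph ::
  "pt set \<Rightarrow> real \<Rightarrow> ('m::finite \<Rightarrow> pt) \<Rightarrow> real \<Rightarrow> (fctl \<times> fctl) set" where
  "closed_loop_graph \<Omega> \<kappa> p lam =
     {(emb \<Omega> (H1 \<Omega>) y, v) | y v. y \<in> L2 \<Omega> \<and> v \<in> Vd \<Omega> \<kappa> \<and> restr (DA \<Omega>) v = closed_loop_op \<Omega> \<kappa> p lam y}"

text \<open>The extension is unique because \<open>V'\<close> is dense in \<open>D(\<A>)'\<close>.\<close>

definition extends_to_DAd ::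
  "pt set \<Rightarrow> real \<Rightarrow> (real \<Rightarrow> fctl \<Rightarrow> fctl) \<Rightarrow> (real \<Rightarrow> fctl \<Rightarrow> fctl) \<Rightarrow> bool" where
  "extends_to_DAd \<Omega> \<kappa> S S' \<longleftrightarrow>
     (\<forall>t\<ge>0. bounded_operator (DAd \<Omega> \<kappa>) (normDAd \<Omega> \<kappa>) (DAd \<Omega> \<kappa>) (normDAd \<Omega> \<kappa>) (S' t) \<and>
            (\<forall>z\<in>Vd \<Omega> \<kappa>. S' t (restr (DA \<Omega>) z) = restr (DA \<Omega>) (S t z)))"

text \<open>\<open>R h = \<integral>\<^sub>0\<^sup>\<infinity> S'(s) h ds\<close> in \<open>D(\<A>)'\<close>, the integral of a function with values in a dual space being
  evaluated through the pairing with \<open>D(\<A>)\<close>.\<close>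

definition semigroup_integral ::
  "pt set \<Rightarrow> real \<Rightarrow> (real \<Rightarrow> fctl \<Rightarrow> fctl) \<Rightarrow> (fctl \<Rightarrow> fctl) \<Rightarrow> bool" where
  "semigroup_integral \<Omega> \<kappa> S' R \<longleftrightarrow>
     (\<forall>h\<in>DAd \<Omega> \<kappa>. \<forall>w\<in>DA \<Omega>. set_integrable lborel {0..} (\<lambda>s. S' s h w) \<and>
        R h w = (LBINT s:{0..}. S' s h w))"

end

theory Submission
  imports Defs
begin

text \<open>
  On \<open>X\<^sub>N\<close> the feedforward cancels exactly the low modes of the residual, so that
  \<open>A\<^sub>0 y + B U y = (I - P\<^sub>N) B U y\<close> by the symmetry of \<open>A\<^sub>0\<close>; applying \<open>R\<close> and \<open>I - P\<^sub>N\<close> and multiplying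
  operator norms gives the error bound, and the Neumann argument bounds \<open>(I + T\<^sub>N)\<^sup>-\<^sup>1\<close>.
  The analytic content lies in the definitions: weak gradients are chosen by \<open>SOME\<close>, so the linearity
  of \<open>A\<^sub>0\<close> rests on their uniqueness, that is, on the fundamental lemma of the calculus of variations;
  and operator norms are suprema of reals, so every operator has to be shown bounded. On \<open>X\<^sub>N\<close> with its
  arbitrary norm this is a compactness argument in the coefficients.
\<close>


subsection \<open>Spaces of functions and functionals\<close>

text \<open>The spaces are carriers inside function types, so \<open>U\<close>, \<open>R\<close> and
  \<open>T\<close> are linear only on a carrier, and \<open>normH\<close>, \<open>normV\<close> and
  \<open>normDA\<close> are seminorms: functions that vanish almost everywhere on the domain have
  norm zero. \<open>fun_vs\<close> supplies spans and subspaces for such carriers. Green's formula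
  is built into \<open>DA\<close>, whose boundary condition is the vanishing of the boundary
  functional; symmetry and dissipativity of \<open>A0\<close> are read off from it. Dissipativity
  bounds \<open>normH\<close> by \<open>normDA\<close>, and since \<open>normV\<close> dominates
  \<open>normH\<close> as well, \<open>I - P_N\<close> can be treated once for both duals. The error
  identity itself is algebra: \<open>P_N\<close> sends the limit to \<open>yr\<close>, and the
  components of the limit that come from \<open>ystar\<close> cancel.\<close>

interpretation fun_vs: vector_space "\<lambda>c (f :: 'a \<Rightarrow> real) x. c * f x"
  by unfold_locales (auto simp: fun_eq_iff algebra_simps)

lemma sum_fun_apply: "(\<Sum>k\<in>A. f k) x = (\<Sum>k\<in>A. f k x :: real)"
  by (induction A rule: infinite_finite_induct) (auto simp: zero_fun_def)

section \<open>Operator norms as suprema of quotients\<close>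

lemma opnorm_le:
  assumes "X \<noteq> {}" "0 \<le> C" "\<And>x. x \<in> X \<Longrightarrow> 0 \<le> nX x"
    and "\<And>x. x \<in> X \<Longrightarrow> nY (T x) \<le> C * nX x"
  shows "opnorm X nX nY T \<le> C"
  unfolding opnorm_def
proof (rule cSUP_least[OF \<open>X \<noteq> {}\<close>])
  fix x assume x: "x \<in> X"
  show "nY (T x) / nX x \<le> C"
  proof (cases "nX x = 0")
    case True
    then show ?thesis using \<open>0 \<le> C\<close> by simp
  next
    case False
    then have "nX x > 0" using assms(3)[OF x] by simp
    then show ?thesis using assms(4)[OF x] by (simp add: divide_le_eq)
  qed
qed

text \<open>The supremum of an unbounded set of reals carries no information; the a priori constant
  \<open>C\<close> is what makes the quotients bounded above.\<close>

lemma opnorm_quotient_le: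
  assumes "\<And>x. x \<in> X \<Longrightarrow> 0 \<le> nX x" and "\<And>x. x \<in> X \<Longrightarrow> nY (T x) \<le> C * nX x" and "x \<in> X"
  shows "nY (T x) / nX x \<le> opnorm X nX nY T"
  unfolding opnorm_def
proof (rule cSUP_upper[OF \<open>x \<in> X\<close>], rule bdd_aboveI2)
  fix x assume x: "x \<in> X"
  \<comment> \<open>Elements of seminorm zero contribute the quotient \<open>0\<close>, even if
    \<open>C\<close> is negative.\<close>
  show "nY (T x) / nX x \<le> max 0 C"
  proof (cases "nX x = 0")
    case False
    then have "nX x > 0" using assms(1)[OF x] by simp
    then have "nY (T x) / nX x \<le> C" using assms(2)[OF x] by (simp add: divide_le_eq)
    then show ?thesis by simp
  qed simp
qed

text \<open>On elements of seminorm zero the quotient says nothing; there the a priori bound forces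
  \<open>nY (T x) \<le> 0\<close>.\<close>

lemma opnorm_bound:
  assumes "\<And>x. x \<in> X \<Longrightarrow> 0 \<le> nX x" and "\<And>x. x \<in> X \<Longrightarrow> nY (T x) \<le> C * nX x" and "x \<in> X"
  shows "nY (T x) \<le> opnorm X nX nY T * nX x"
proof (cases "nX x = 0")
  case True
  then show ?thesis using assms(2)[OF \<open>x \<in> X\<close>] by simp
next
  case False
  then have "nX x > 0" using assms(1)[OF \<open>x \<in> X\<close>] by simp
  then show ?thesis using opnorm_quotient_le[of X nX nY T C x] assms by (simp add: divide_le_eq)
qed

lemma opnorm_nonneg:
  assumes "\<And>x. x \<in> X \<Longrightarrow> 0 \<le> nX x" and "\<And>x. x \<in> X \<Longrightarrow> nY (T x) \<le> C * nX x"
    and "\<And>x. x \<in> X \<Longrightarrow> 0 \<le> nY (T x)" and "X \<noteq> {}"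
  shows "0 \<le> opnorm X nX nY T"
proof -
  obtain x where x: "x \<in> X" using \<open>X \<noteq> {}\<close> by blast
  have "0 \<le> nY (T x) / nX x" using assms(1,3)[OF x] by simp
  also have "\<dots> \<le> opnorm X nX nY T" by (rule opnorm_quotient_le[of X nX nY T C]) (use assms x in auto)
  finally show ?thesis .
qed

section \<open>Bounded functionals and the dual norm\<close>

lemma dual_boundedE:
  assumes "F \<in> dual X n"
  obtains C where "\<And>u. u \<in> X \<Longrightarrow> \<bar>F u\<bar> \<le> C * n u"
  using assms unfolding dual_def by blast

lemma dual_apply_le:
  assumes "F \<in> dual X n" "\<And>u. u \<in> X \<Longrightarrow> 0 \<le> n u" "u \<in> X"
  shows "\<bar>F u\<bar> \<le> dual_norm X n F * n u"
proof -
  obtain C where "\<And>u. u \<in> X \<Longrightarrow> \<bar>F u\<bar> \<le> C * n u" using assms(1) by (rule dual_boundedE) blast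
  then show ?thesis unfolding dual_norm_def using opnorm_bound[of X n abs F C u] assms by blast
qed

lemma dual_norm_nonneg:
  assumes "F \<in> dual X n" "\<And>u. u \<in> X \<Longrightarrow> 0 \<le> n u" "X \<noteq> {}"
  shows "0 \<le> dual_norm X n F"
proof -
  obtain C where "\<And>u. u \<in> X \<Longrightarrow> \<bar>F u\<bar> \<le> C * n u" using assms(1) by (rule dual_boundedE) blast
  then show ?thesis unfolding dual_norm_def using opnorm_nonneg[of X n abs F C] assms by auto
qed

lemma dual_norm_le:
  assumes "X \<noteq> {}" "0 \<le> C" "\<And>u. u \<in> X \<Longrightarrow> 0 \<le> n u" "\<And>u. u \<in> X \<Longrightarrow> \<bar>F u\<bar> \<le> C * n u"
  shows "dual_norm X n F \<le> C"
  unfolding dual_norm_def using assms by (rule opnorm_le)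

lemma subspace_dual: "fun_vs.subspace (dual X n)"
  unfolding fun_vs.subspace_def
proof (intro conjI ballI allI)
  show "0 \<in> dual X n" by (auto simp: dual_def intro!: exI[of _ 0])
next
  fix F G assume F: "F \<in> dual X n" and G: "G \<in> dual X n"
  obtain C where C: "\<And>u. u \<in> X \<Longrightarrow> \<bar>F u\<bar> \<le> C * n u" using F by (rule dual_boundedE) blast
  obtain D where D: "\<And>u. u \<in> X \<Longrightarrow> \<bar>G u\<bar> \<le> D * n u" using G by (rule dual_boundedE) blast
  have "\<bar>F u + G u\<bar> \<le> (C + D) * n u" if "u \<in> X" for u
    using C[OF that] D[OF that] by (simp add: algebra_simps)
  then show "F + G \<in> dual X n"
    using F G by (auto simp: dual_def algebra_simps intro!: exI[of _ "C + D"])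
next
  fix c :: real and F assume F: "F \<in> dual X n"
  obtain C where C: "\<And>u. u \<in> X \<Longrightarrow> \<bar>F u\<bar> \<le> C * n u" using F by (rule dual_boundedE) blast
  have "\<bar>c * F u\<bar> \<le> (\<bar>c\<bar> * C) * n u" if "u \<in> X" for u
    using mult_left_mono[OF C[OF that], of "\<bar>c\<bar>"] by (simp add: abs_mult mult.assoc)
  then show "(\<lambda>u. c * F u) \<in> dual X n"
    using F by (auto simp: dual_def algebra_simps intro!: exI[of _ "\<bar>c\<bar> * C"])
qed

text \<open>A dimension count for a map that is linear and injective only on the subspace
  \<open>V\<close>. Since \<open>f\<close> is arbitrary off \<open>V\<close>, it is replaced by a
  globally linear \<open>g\<close> that agrees with it on a basis of \<open>V\<close>. This is what
  makes \<open>I + T\<close> surjective on \<open>XN\<close>.\<close>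

lemma (in vector_space) inj_on_span_imp_surj:
  assumes "finite T" and V: "V = span T"
    and add: "\<And>u v. u \<in> V \<Longrightarrow> v \<in> V \<Longrightarrow> f (u + v) = f u + f v"
    and scl: "\<And>c u. u \<in> V \<Longrightarrow> f (scale c u) = scale c (f u)"
    and maps: "f ` V \<subseteq> V" and inj: "inj_on f V"
  shows "f ` V = V"
proof -
  interpret vsp: vector_space_pair scale scale ..
  obtain B where B: "B \<subseteq> V" "independent B" "V \<subseteq> span B"
    using maximal_independent_subset by blast
  have VB: "V = span B"
    using B V by (metis span_mono span_span subset_antisym)
  have finB: "finite B" using independent_span_bound[OF \<open>finite T\<close> \<open>independent B\<close>] B V by simp
  obtain g where g: "Vector_Spaces.linear scale scale g" "\<forall>x\<in>B. g x = f x"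
    using vsp.linear_independent_extend[OF B(2), of f] by blast
  interpret g: Vector_Spaces.linear scale scale g by fact
  have gf: "g x = f x" if "x \<in> V" for x
  proof -
    have "x \<in> span B" using that VB by simp
    \<comment> \<open>Membership in \<open>V\<close> is carried through the induction because
      \<open>add\<close> and \<open>scl\<close> are available only there.\<close>
    then have "x \<in> V \<and> g x = f x"
    proof (induction rule: span_induct_alt)
      case base
      have "0 \<in> V" using V span_zero by simp
      then show ?case using scl[of 0 0] by (simp add: g.zero)
    next
      case (step c x y)
      have xV: "x \<in> V" using step B by blast
      then have "scale c x \<in> V" using V span_scale by simp
      moreover have "scale c x + y \<in> V" using calculation step V span_add by simp
      ultimately show ?case
        using step add[of "scale c x" y] scl[OF xV, of c] g(2)
        by (simp add: g.add g.scale)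
    qed
    then show ?thesis by simp
  qed
  have ind: "independent (g ` B)"
    using g.independent_injective_image[OF B(2)] inj gf VB by (metis (no_types, lifting) inj_on_cong)
  have injB: "inj_on g B"
    using inj gf B(1) by (metis (no_types, lifting) inj_on_def subset_iff)
  have "V \<subseteq> span (g ` B)"
  proof
    fix v assume v: "v \<in> V"
    show "v \<in> span (g ` B)"
    proof (rule ccontr)
      \<comment> \<open>Together with the images of the basis, \<open>v\<close> would give more
        independent vectors in \<open>span B\<close> than \<open>B\<close> has elements.\<close>
      assume nv: "v \<notin> span (g ` B)"
      then have "independent (insert v (g ` B))" using ind by (simp add: independent_insert)
      moreover have "insert v (g ` B) \<subseteq> span B"
        using v maps gf B(1) VB by auto
      ultimately have "card (insert v (g ` B)) \<le> card B"
        using independent_span_bound[OF finB] by blast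
      moreover have "v \<notin> g ` B" using nv span_base by blast
      ultimately show False using finB injB by (simp add: card_image)
    qed
  qed
  also have "\<dots> = g ` V" using g.span_image[of B] VB by simp
  also have "\<dots> = f ` V" using gf by simp
  finally show ?thesis using maps by blast
qed


subsection \<open>The space \<open>X\<^sub>N\<close>\<close>

text \<open>The coefficient form serves the estimates, the span form the closure properties and the
  dimension count.\<close>

lemma XN_eq_span: "XN \<phi> N = fun_vs.span (\<phi> ` {1..N})"
proof -
  have "(\<lambda>x. \<Sum>k=1..N. c k * \<phi> k x) \<in> fun_vs.span (\<phi> ` {1..N})" for c
  proof -
    have "(\<Sum>k\<in>{1..N}. (\<lambda>x. c k * \<phi> k x)) \<in> fun_vs.span (\<phi> ` {1..N})"
      by (intro fun_vs.span_sum fun_vs.span_scale fun_vs.span_base) auto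
    moreover have "(\<Sum>k\<in>{1..N}. (\<lambda>x. c k * \<phi> k x)) = (\<lambda>x. \<Sum>k=1..N. c k * \<phi> k x)"
      by (simp add: fun_eq_iff sum_fun_apply)
    ultimately show ?thesis by simp
  qed
  moreover have "fun_vs.subspace (XN \<phi> N)"
    unfolding fun_vs.subspace_def
  proof (intro conjI ballI allI)
    show "0 \<in> XN \<phi> N" by (auto simp: XN_def fun_eq_iff intro!: exI[of _ "\<lambda>_. 0"])
  next
    fix u v assume "u \<in> XN \<phi> N" "v \<in> XN \<phi> N"
    then obtain c d where "u = (\<lambda>x. \<Sum>k=1..N. c k * \<phi> k x)" "v = (\<lambda>x. \<Sum>k=1..N. d k * \<phi> k x)"
      by (auto simp: XN_def)
    then show "u + v \<in> XN \<phi> N"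
      by (auto simp: XN_def fun_eq_iff sum.distrib algebra_simps intro!: exI[of _ "\<lambda>k. c k + d k"])
  next
    fix a :: real and u assume "u \<in> XN \<phi> N"
    then obtain c where "u = (\<lambda>x. \<Sum>k=1..N. c k * \<phi> k x)" by (auto simp: XN_def)
    then show "(\<lambda>x. a * u x) \<in> XN \<phi> N"
      by (auto simp: XN_def fun_eq_iff sum_distrib_left algebra_simps intro!: exI[of _ "\<lambda>k. a * c k"])
  qed
  moreover have "\<phi> ` {1..N} \<subseteq> XN \<phi> N"
  proof
    fix f assume "f \<in> \<phi> ` {1..N}"
    then obtain k where k: "k \<in> {1..N}" "f = \<phi> k" by blast
    then have "f = (\<lambda>x. \<Sum>j=1..N. (if j = k then 1 else 0) * \<phi> j x)"
      by (auto simp: fun_eq_iff if_distrib[of "\<lambda>a. a * _"] cong: if_cong)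
    then show "f \<in> XN \<phi> N" unfolding XN_def by (intro CollectI exI)
  qed
  ultimately show ?thesis
    using fun_vs.span_minimal[of "\<phi> ` {1..N}" "XN \<phi> N"] unfolding XN_def by blast
qed

lemma subspace_XN: "fun_vs.subspace (XN \<phi> N)"
  by (simp add: XN_eq_span fun_vs.subspace_span)

text \<open>By compactness, the norm has a positive minimum on the coefficient sphere
  \<open>\<Sum>\<bar>c\<^sub>k\<bar> = 1\<close>.\<close>

lemma XN_coefficients_bounded:
  fixes \<phi> :: "nat \<Rightarrow> fld"
  assumes nrm: "is_norm_on (XN \<phi> N) n"
    and ind: "\<forall>c. (\<lambda>x. \<Sum>k=1..N. c k * \<phi> k x) = (\<lambda>x. 0) \<longrightarrow> (\<forall>k\<in>{1..N}. c k = 0)"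
  shows "\<exists>C. \<forall>c. (\<Sum>k=1..N. \<bar>c k\<bar>) \<le> C * n (\<lambda>x. \<Sum>k=1..N. c k * \<phi> k x)"
proof (cases "N = 0")
  \<comment> \<open>For \<open>N = 0\<close> the coefficient sphere is empty and has no minimum, but
    the sum to be bounded is empty too.\<close>
  case True
  then show ?thesis by (intro exI[of _ 0]) auto
next
  case False
  define L where "L c = (\<lambda>x. \<Sum>k=1..N. c k * \<phi> k x)" for c :: "nat \<Rightarrow> real"
  have LX: "L c \<in> XN \<phi> N" for c unfolding L_def XN_def by blast
  have phiX: "\<phi> k \<in> XN \<phi> N" if "k \<in> {1..N}" for k
    using that by (simp add: XN_eq_span fun_vs.span_base)
  have n0: "0 \<le> n u" if "u \<in> XN \<phi> N" for u using nrm that by (auto simp: is_norm_on_def)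
  have nadd: "n (u + v) \<le> n u + n v" if "u \<in> XN \<phi> N" "v \<in> XN \<phi> N" for u v
    using nrm that by (auto simp: is_norm_on_def)
  have nscl: "n (\<lambda>x. a * u x) = \<bar>a\<bar> * n u" if "u \<in> XN \<phi> N" for u a
    using nrm that by (auto simp: is_norm_on_def)
  have nL: "n (L c) \<le> (\<Sum>k=1..N. \<bar>c k\<bar> * n (\<phi> k))" for c
  proof -
    have "n (\<lambda>x. \<Sum>k\<in>A. c k * \<phi> k x) \<le> (\<Sum>k\<in>A. \<bar>c k\<bar> * n (\<phi> k)) \<and>
        (\<lambda>x. \<Sum>k\<in>A. c k * \<phi> k x) \<in> XN \<phi> N" if "A \<subseteq> {1..N}" for A
      using finite_subset[OF that finite_atLeastAtMost] that
    proof (induction A rule: finite_induct)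
      case empty
      have "0 \<in> XN \<phi> N" using fun_vs.subspace_0[OF subspace_XN] .
      then show ?case using nscl[of 0 0] by (simp add: zero_fun_def)
    next
      case (insert j A)
      then have j: "\<phi> j \<in> XN \<phi> N" using phiX by auto
      have cj: "(\<lambda>x. c j * \<phi> j x) \<in> XN \<phi> N"
        using fun_vs.subspace_scale[OF subspace_XN j] .
      have eq: "(\<lambda>x. \<Sum>k\<in>insert j A. c k * \<phi> k x) = (\<lambda>x. c j * \<phi> j x) + (\<lambda>x. \<Sum>k\<in>A. c k * \<phi> k x)"
        using insert by (simp add: fun_eq_iff)
      show ?case unfolding eq
        using insert nadd[OF cj, of "\<lambda>x. \<Sum>k\<in>A. c k * \<phi> k x"] nscl[OF j, of "c j"]
          fun_vs.subspace_add[OF subspace_XN cj] by auto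
    qed
    then show ?thesis unfolding L_def by blast
  qed
  have Ladd: "L c + L d = L (\<lambda>k. c k + d k)" for c d
    by (simp add: L_def fun_eq_iff sum.distrib algebra_simps)
  \<comment> \<open>The reverse triangle inequality in coefficients: the norm depends on finitely
    many coordinates in a Lipschitz way, hence continuously for the product topology on
    \<open>nat \<Rightarrow> real\<close>.\<close>
  have ndiff: "\<bar>n (L c) - n (L d)\<bar> \<le> (\<Sum>k=1..N. \<bar>c k - d k\<bar> * n (\<phi> k))" for c d
  proof -
    have "n (L c) \<le> n (L d) + n (L (\<lambda>k. c k - d k))"
      using nadd[OF LX LX, of d "\<lambda>k. c k - d k"] by (simp add: Ladd)
    moreover have "n (L d) \<le> n (L c) + n (L (\<lambda>k. d k - c k))"
      using nadd[OF LX LX, of c "\<lambda>k. d k - c k"] by (simp add: Ladd)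
    moreover have "(\<Sum>k=1..N. \<bar>d k - c k\<bar> * n (\<phi> k)) = (\<Sum>k=1..N. \<bar>c k - d k\<bar> * n (\<phi> k))"
      by (simp add: abs_minus_commute)
    ultimately show ?thesis
      using nL[of "\<lambda>k. c k - d k"] nL[of "\<lambda>k. d k - c k"] by linarith
  qed
  have cont: "continuous_on UNIV (\<lambda>c. n (L c))"
    unfolding continuous_on_def
  proof
    fix d :: "nat \<Rightarrow> real"
    have "continuous_on UNIV (\<lambda>c::nat \<Rightarrow> real. \<Sum>k=1..N. \<bar>c k - d k\<bar> * n (\<phi> k))"
      by (intro continuous_intros continuous_on_product_coordinates)
    then have "((\<lambda>c. \<Sum>k=1..N. \<bar>c k - d k\<bar> * n (\<phi> k)) \<longlongrightarrow> 0) (at d)"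
      unfolding continuous_on_def by (drule_tac x = d in bspec) simp_all
    then have "((\<lambda>c. n (L c) - n (L d)) \<longlongrightarrow> 0) (at d)"
      by (rule Lim_null_comparison[rotated]) (rule always_eventually, rule allI, unfold real_norm_def, rule ndiff)
    then show "((\<lambda>c. n (L c)) \<longlongrightarrow> n (L d)) (at d)"
      by (simp add: LIM_zero_iff)
  qed
  \<comment> \<open>Coefficients are total functions on \<open>nat\<close>; freezing those outside
    \<open>{1..N}\<close> at \<open>0\<close> gives a product of compact sets, to which Tychonoff's
    theorem applies.\<close>
  define P where "P = (PiE UNIV (\<lambda>k::nat. if k \<in> {1..N} then {-1..1} else {0::real}))"
  define S where "S = P \<inter> {c. (\<Sum>k=1..N. \<bar>c k\<bar>) = 1}"
  have "compactin (product_topology (\<lambda>_. euclidean) UNIV) P"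
    unfolding P_def by (subst compactin_PiE) auto
  then have "compact P" by (simp add: euclidean_product_topology)
  moreover have "closed {c::nat \<Rightarrow> real. (\<Sum>k=1..N. \<bar>c k\<bar>) = 1}"
    by (intro closed_Collect_eq continuous_intros continuous_on_product_coordinates)
  ultimately have "compact S" unfolding S_def by (rule compact_Int_closed)
  \<comment> \<open>A minimum needs a nonempty set; the index \<open>1\<close> is available because
    \<open>N\<close> is not \<open>0\<close>.\<close>
  moreover have "(\<lambda>k. if k = 1 then 1 else 0) \<in> S"
    using False by (auto simp: S_def P_def if_distrib[of abs] cong: if_cong)
  ultimately obtain c0 where c0: "c0 \<in> S" "\<And>c. c \<in> S \<Longrightarrow> n (L c0) \<le> n (L c)"
    using continuous_attains_inf[of S "\<lambda>c. n (L c)"] continuous_on_subset[OF cont] by blast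
  have "n (L c0) \<noteq> 0"
  proof
    assume "n (L c0) = 0"
    then have "L c0 = (\<lambda>x. 0)" using nrm LX by (auto simp: is_norm_on_def)
    then have "c0 k = 0" if "k \<in> {1..N}" for k using ind[THEN spec[of _ c0]] that by (simp add: L_def)
    then show False using c0(1) by (simp add: S_def)
  qed
  then have m: "n (L c0) > 0" using n0[OF LX, of c0] by linarith
  \<comment> \<open>The constant is the inverse of the minimum; other nonzero coefficient vectors
    are scaled to the sphere by homogeneity.\<close>
  have "(\<Sum>k=1..N. \<bar>c k\<bar>) \<le> inverse (n (L c0)) * n (L c)" for c
  proof (cases "(\<Sum>k=1..N. \<bar>c k\<bar>) = 0")
    case True
    then show ?thesis using m n0[OF LX, of c] by simp
  next
    case False
    define s where "s = (\<Sum>k=1..N. \<bar>c k\<bar>)"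
    have s: "s > 0" using False unfolding s_def by (metis abs_ge_zero less_eq_real_def sum_nonneg)
    define d where "d k = (if k \<in> {1..N} then c k / s else 0)" for k
    have "\<bar>c k\<bar> \<le> s" if "k \<in> {1..N}" for k
      unfolding s_def using that by (intro member_le_sum) auto
    then have "d \<in> P" using s by (auto simp: P_def d_def divide_le_eq le_divide_eq abs_le_iff, fastforce+)
    moreover have "(\<Sum>k=1..N. \<bar>d k\<bar>) = (\<Sum>k=1..N. \<bar>c k\<bar> / s)"
      using s by (simp add: d_def)
    then have "(\<Sum>k=1..N. \<bar>d k\<bar>) = 1"
      unfolding sum_divide_distrib[symmetric] s_def[symmetric] using s by simp
    ultimately have "n (L c0) \<le> n (L d)" using c0(2) by (simp add: S_def)
    also have "L d = (\<lambda>x. inverse s * L c x)"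
      by (simp add: L_def d_def fun_eq_iff sum_distrib_left divide_inverse mult_ac)
    also have "n \<dots> = inverse s * n (L c)" using nscl[OF LX, of "inverse s" c] s by simp
    finally show ?thesis using m s unfolding s_def[symmetric] by (simp add: field_simps)
  qed
  then show ?thesis unfolding L_def by blast
qed

text \<open>By subadditivity \<open>g y\<close> is at most the sum of
  \<open>\<bar>c k\<bar> * g (\<phi> k)\<close>, and the arbitrary norm controls the coefficients.
  It is applied to \<open>normX (T y)\<close>, to \<open>norm (U y)\<close> and to the norm of the
  inverse of \<open>I + T\<close>.\<close>

lemma seminorm_XN_bounded:
  fixes \<phi> :: "nat \<Rightarrow> fld"
  assumes nrm: "is_norm_on (XN \<phi> N) n"
    and ind: "\<forall>c. (\<lambda>x. \<Sum>k=1..N. c k * \<phi> k x) = (\<lambda>x. 0) \<longrightarrow> (\<forall>k\<in>{1..N}. c k = 0)"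
    and gadd: "\<And>u v. u \<in> XN \<phi> N \<Longrightarrow> v \<in> XN \<phi> N \<Longrightarrow> g (u + v) \<le> g u + g v"
    and gscl: "\<And>u a. u \<in> XN \<phi> N \<Longrightarrow> g (\<lambda>x. a * u x) = \<bar>a\<bar> * g u"
  shows "\<exists>C::real. \<forall>y\<in>XN \<phi> N. g y \<le> C * n y"
proof -
  obtain C where C: "\<And>c. (\<Sum>k=1..N. \<bar>c k\<bar>) \<le> C * n (\<lambda>x. \<Sum>k=1..N. c k * \<phi> k x)"
    using XN_coefficients_bounded[OF nrm ind] by blast
  have phiX: "\<phi> k \<in> XN \<phi> N" if "k \<in> {1..N}" for k
    using that by (simp add: XN_eq_span fun_vs.span_base)
  \<comment> \<open>The absolute values make \<open>K\<close> nonnegative and an upper bound of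
    every \<open>g (\<phi> k)\<close>.\<close>
  define K where "K = (\<Sum>k=1..N. \<bar>g (\<phi> k)\<bar>)"
  have K: "g (\<phi> k) \<le> K" if "k \<in> {1..N}" for k
    using member_le_sum[of k "{1..N}" "\<lambda>k. \<bar>g (\<phi> k)\<bar>"] that unfolding K_def by fastforce
  have K0: "K \<ge> 0" unfolding K_def by (rule sum_nonneg) simp
  have "g y \<le> (K * C) * n y" if y: "y \<in> XN \<phi> N" for y
  proof -
    obtain c where c: "y = (\<lambda>x. \<Sum>k=1..N. c k * \<phi> k x)" using y by (auto simp: XN_def)
    have "g (\<lambda>x. \<Sum>k\<in>A. c k * \<phi> k x) \<le> (\<Sum>k\<in>A. \<bar>c k\<bar> * K) \<and>
        (\<lambda>x. \<Sum>k\<in>A. c k * \<phi> k x) \<in> XN \<phi> N" if "A \<subseteq> {1..N}" for A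
      using finite_subset[OF that finite_atLeastAtMost] that
    proof (induction A rule: finite_induct)
      case empty
      have "0 \<in> XN \<phi> N" using fun_vs.subspace_0[OF subspace_XN] .
      then show ?case using gscl[of 0 0] by (simp add: zero_fun_def)
    next
      case (insert j A)
      then have j: "\<phi> j \<in> XN \<phi> N" and gj: "\<bar>c j\<bar> * g (\<phi> j) \<le> \<bar>c j\<bar> * K"
        using phiX K[of j] by (auto intro: mult_left_mono)
      have cj: "(\<lambda>x. c j * \<phi> j x) \<in> XN \<phi> N"
        using fun_vs.subspace_scale[OF subspace_XN j] .
      have eq: "(\<lambda>x. \<Sum>k\<in>insert j A. c k * \<phi> k x) = (\<lambda>x. c j * \<phi> j x) + (\<lambda>x. \<Sum>k\<in>A. c k * \<phi> k x)"
        using insert by (simp add: fun_eq_iff)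
      show ?case unfolding eq
        using insert gadd[OF cj, of "\<lambda>x. \<Sum>k\<in>A. c k * \<phi> k x"] gscl[OF j, of "c j"] gj
          fun_vs.subspace_add[OF subspace_XN cj] by auto
    qed
    then have "g y \<le> (\<Sum>k=1..N. \<bar>c k\<bar> * K)" unfolding c by blast
    also have "\<dots> = K * (\<Sum>k=1..N. \<bar>c k\<bar>)" by (simp add: sum_distrib_left mult.commute)
    also have "\<dots> \<le> K * (C * n y)" unfolding c using C K0 by (intro mult_left_mono)
    finally show ?thesis by (simp add: mult.assoc)
  qed
  then show ?thesis by blast
qed


subsection \<open>The Lebesgue space\<close>

lemma L2_integrable_mult:
  assumes "u \<in> L2 \<Omega>" "v \<in> L2 \<Omega>"
  shows "integrable (lebesgue_on \<Omega>) (\<lambda>x. u x * v x)"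
proof (rule Bochner_Integration.integrable_bound)
  show "integrable (lebesgue_on \<Omega>) (\<lambda>x. (u x)\<^sup>2 + (v x)\<^sup>2)"
    using assms by (auto simp: L2_def)
  show "(\<lambda>x. u x * v x) \<in> borel_measurable (lebesgue_on \<Omega>)"
    using assms by (auto simp: L2_def intro: borel_measurable_times)
  have "\<bar>a * b\<bar> \<le> a\<^sup>2 + b\<^sup>2" for a b :: real
  proof -
    have "2 * \<bar>a * b\<bar> \<le> a\<^sup>2 + b\<^sup>2"
      using sum_squares_bound[of "\<bar>a\<bar>" "\<bar>b\<bar>"] by (simp add: abs_mult)
    then show ?thesis by linarith
  qed
  then show "AE x in lebesgue_on \<Omega>. norm (u x * v x) \<le> norm ((u x)\<^sup>2 + (v x)\<^sup>2)"
    by simp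
qed

lemma L2_measurable: "u \<in> L2 \<Omega> \<Longrightarrow> u \<in> borel_measurable (lebesgue_on \<Omega>)"
  by (simp add: L2_def)

lemma subspace_L2: "fun_vs.subspace (L2 \<Omega>)"
  unfolding fun_vs.subspace_def
proof (intro conjI ballI allI)
  show "0 \<in> L2 \<Omega>" by (simp add: L2_def zero_fun_def)
next
  fix u v assume uv: "u \<in> L2 \<Omega>" "v \<in> L2 \<Omega>"
  have "integrable (lebesgue_on \<Omega>) (\<lambda>x. (u x)\<^sup>2 + (v x)\<^sup>2 + 2 * (u x * v x))"
    using uv L2_integrable_mult[OF uv] by (auto simp: L2_def)
  then have "integrable (lebesgue_on \<Omega>) (\<lambda>x. (u x + v x)\<^sup>2)"
    by (simp add: power2_sum mult.assoc)
  then show "u + v \<in> L2 \<Omega>"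
    using uv by (auto simp: L2_def plus_fun_def)
next
  fix c :: real and u assume "u \<in> L2 \<Omega>"
  then show "(\<lambda>x. c * u x) \<in> L2 \<Omega>"
    by (auto simp: L2_def power_mult_distrib)
qed

lemmas L2_add = fun_vs.subspace_add[OF subspace_L2, unfolded plus_fun_def]
lemmas L2_scale = fun_vs.subspace_scale[OF subspace_L2]

lemma L2_lincomb:
  assumes "\<And>k. k \<in> A \<Longrightarrow> f k \<in> L2 \<Omega>"
  shows "(\<lambda>x. \<Sum>k\<in>A. c k * f k x) \<in> L2 \<Omega>"
proof -
  have "(\<Sum>k\<in>A. (\<lambda>x. c k * f k x)) \<in> L2 \<Omega>"
    using assms by (intro fun_vs.subspace_sum[OF subspace_L2] L2_scale)
  moreover have "(\<Sum>k\<in>A. (\<lambda>x. c k * f k x)) = (\<lambda>x. \<Sum>k\<in>A. c k * f k x)"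
    by (simp add: fun_eq_iff sum_fun_apply)
  ultimately show ?thesis by simp
qed

section \<open>Inner product and seminorm of L2\<close>

lemma ipH_commute: "ipH \<Omega> u v = ipH \<Omega> v u"
  by (simp add: ipH_def mult.commute)

lemma ipH_add_left:
  assumes "u \<in> L2 \<Omega>" "v \<in> L2 \<Omega>" "w \<in> L2 \<Omega>"
  shows "ipH \<Omega> (\<lambda>x. u x + v x) w = ipH \<Omega> u w + ipH \<Omega> v w"
  using assms by (simp add: ipH_def distrib_right L2_integrable_mult)

lemma ipH_add_right:
  assumes "u \<in> L2 \<Omega>" "v \<in> L2 \<Omega>" "w \<in> L2 \<Omega>"
  shows "ipH \<Omega> w (\<lambda>x. u x + v x) = ipH \<Omega> w u + ipH \<Omega> w v"
  using ipH_add_left[OF assms] by (simp add: ipH_commute)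

lemma ipH_scale_left: "ipH \<Omega> (\<lambda>x. c * u x) w = c * ipH \<Omega> u w"
  by (simp add: ipH_def mult.assoc)

lemma ipH_scale_right: "ipH \<Omega> w (\<lambda>x. c * u x) = c * ipH \<Omega> w u"
  by (metis ipH_commute ipH_scale_left)

lemma ipH_lincomb_left:
  assumes "\<And>k. k \<in> A \<Longrightarrow> f k \<in> L2 \<Omega>" "w \<in> L2 \<Omega>"
  shows "ipH \<Omega> (\<lambda>x. \<Sum>k\<in>A. c k * f k x) w = (\<Sum>k\<in>A. c k * ipH \<Omega> (f k) w)"
  using assms by (simp add: ipH_def sum_distrib_right L2_integrable_mult mult.assoc)

lemma ipH_cong_AE:
  assumes "u \<in> L2 \<Omega>" "u' \<in> L2 \<Omega>" "w \<in> L2 \<Omega>" "AE x in lebesgue_on \<Omega>. u x = u' x"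
  shows "ipH \<Omega> u w = ipH \<Omega> u' w"
  unfolding ipH_def
  by (rule integral_cong_AE) (use assms in \<open>auto intro: borel_measurable_times dest: L2_measurable\<close>)

lemma ipH_self_nonneg: "0 \<le> ipH \<Omega> u u"
  by (simp add: ipH_def)

lemma normH_nonneg: "0 \<le> normH \<Omega> u"
  by (simp add: normH_def ipH_self_nonneg)

lemma normH_sq: "(normH \<Omega> u)\<^sup>2 = ipH \<Omega> u u"
  by (simp add: normH_def ipH_self_nonneg)

lemma ipH_Cauchy_Schwarz:
  assumes u: "u \<in> L2 \<Omega>" and v: "v \<in> L2 \<Omega>"
  shows "\<bar>ipH \<Omega> u v\<bar> \<le> normH \<Omega> u * normH \<Omega> v"
proof (cases "ipH \<Omega> v v = 0")
  \<comment> \<open>Here \<open>v\<close> vanishes almost everywhere but need not be the zero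
    function.\<close>
  case True
  have "AE x in lebesgue_on \<Omega>. v x * v x = 0"
    using True integral_nonneg_eq_0_iff_AE[OF L2_integrable_mult[OF v v]] by (simp add: ipH_def)
  then have "AE x in lebesgue_on \<Omega>. u x * v x = 0" by (rule AE_mp) simp
  then have "ipH \<Omega> u v = 0" unfolding ipH_def by (rule integral_eq_zero_AE)
  then show ?thesis by (simp add: normH_nonneg)
next
  case False
  \<comment> \<open>The minimizer of the squared norm of \<open>u - t v\<close>.\<close>
  define t where "t = ipH \<Omega> u v / ipH \<Omega> v v"
  have V: "ipH \<Omega> v v > 0" using False ipH_self_nonneg[of \<Omega> v] by simp
  have tv: "(\<lambda>x. - t * v x) \<in> L2 \<Omega>" by (rule L2_scale[OF v])
  have "0 \<le> ipH \<Omega> (\<lambda>x. u x + - t * v x) (\<lambda>x. u x + - t * v x)" by (rule ipH_self_nonneg)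
  also have "\<dots> = ipH \<Omega> u u - 2 * t * ipH \<Omega> u v + t\<^sup>2 * ipH \<Omega> v v"
    using u v tv L2_add[OF u tv] unfolding ipH_add_left[OF u tv L2_add[OF u tv]]
      ipH_add_right[OF u tv u] ipH_add_right[OF u tv v] ipH_scale_left ipH_scale_right
    by (simp add: ipH_commute[of \<Omega> v u] power2_eq_square algebra_simps)
  also have "\<dots> = ipH \<Omega> u u - (ipH \<Omega> u v)\<^sup>2 / ipH \<Omega> v v"
    using V by (simp add: t_def power2_eq_square)
  finally have "(ipH \<Omega> u v)\<^sup>2 \<le> ipH \<Omega> u u * ipH \<Omega> v v"
    using V by (simp add: divide_le_eq)
  then have "(ipH \<Omega> u v)\<^sup>2 \<le> (normH \<Omega> u * normH \<Omega> v)\<^sup>2"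
    by (simp add: power_mult_distrib normH_sq)
  then show ?thesis
    by (simp add: normH_nonneg flip: abs_le_square_iff)
qed


subsection \<open>Bump functions and the fundamental lemma\<close>

text \<open>The classical flat function \<open>exp (- 1 / t)\<close>, together with its multiples by
  all powers of \<open>1 / t\<close>, so that derivatives of members are linear combinations of
  members.\<close>

definition flat_exp :: "nat \<Rightarrow> real \<Rightarrow> real" where
  "flat_exp n t = (if t \<le> 0 then 0 else exp (- inverse t) * inverse t ^ n)"

lemma flat_exp_nonneg: "0 \<le> flat_exp n t"
  by (simp add: flat_exp_def)

lemma flat_exp_0_le_1: "flat_exp 0 t \<le> 1"
  by (simp add: flat_exp_def)

text \<open>On the right of \<open>0\<close> the substitution \<open>s = 1 / t\<close> turns the
  claim into the decay of \<open>s ^ n / exp s\<close>.\<close>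

lemma flat_exp_tendsto_0: "(flat_exp n \<longlongrightarrow> 0) (at 0)"
proof (subst filterlim_at_split, rule conjI)
  have "eventually (\<lambda>t. flat_exp n t = 0) (at_left 0)"
    by (auto simp: eventually_at_filter flat_exp_def)
  then show "(flat_exp n \<longlongrightarrow> 0) (at_left 0)"
    by (rule tendsto_eventually)
  have "((\<lambda>s::real. s ^ n / exp s) \<longlongrightarrow> 0) at_top"
    by (rule tendsto_power_div_exp_0)
  then have "((\<lambda>t::real. inverse t ^ n / exp (inverse t)) \<longlongrightarrow> 0) (at_right 0)"
    by (rule filterlim_compose[OF _ filterlim_inverse_at_top_right])
  moreover have "eventually (\<lambda>t. inverse t ^ n / exp (inverse t) = flat_exp n t) (at_right (0::real))"
    by (auto simp: eventually_at_filter flat_exp_def exp_minus divide_inverse mult.commute)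
  ultimately show "(flat_exp n \<longlongrightarrow> 0) (at_right 0)"
    by (rule Lim_transform_eventually)
qed

lemma DERIV_flat_exp:
  "(flat_exp n has_real_derivative flat_exp (n + 2) t - real n * flat_exp (n + 1) t) (at t)"
proof (cases t "0::real" rule: linorder_cases)
  case less
  have "((\<lambda>t. 0) has_real_derivative 0) (at t)" by simp
  then have "(flat_exp n has_real_derivative 0) (at t)"
    by (rule has_field_derivative_transform_within_open[where S = "{..<0}"])
      (use less in \<open>auto simp: flat_exp_def\<close>)
  then show ?thesis using less by (simp add: flat_exp_def)
next
  case equal
  \<comment> \<open>At \<open>0\<close> the difference quotient of \<open>flat_exp n\<close> is
    \<open>flat_exp (Suc n)\<close>, so differentiability there is the limit at the next
    index.\<close>
  have "((\<lambda>h. flat_exp n h / h) \<longlongrightarrow> 0) (at 0)"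
  proof (rule Lim_transform_eventually[OF flat_exp_tendsto_0[of "Suc n"]])
    show "eventually (\<lambda>h. flat_exp (Suc n) h = flat_exp n h / h) (at 0)"
      by (auto simp: eventually_at_filter flat_exp_def divide_inverse)
  qed
  then show ?thesis using equal by (simp add: DERIV_def flat_exp_def)
next
  case greater
  \<comment> \<open>The truncated \<open>n - 1\<close> is harmless at \<open>n = 0\<close>, where
    the factor \<open>real n\<close> vanishes.\<close>
  have pow: "real n * (inverse t ^ (n - 1) * (inverse t * inverse t)) = real n * inverse t ^ (n + 1)"
    by (cases n) (simp_all add: mult_ac)
  have "((\<lambda>t. exp (- inverse t) * inverse t ^ n) has_real_derivative
      (exp (- inverse t) * (inverse t * inverse t)) * inverse t ^ n
      + exp (- inverse t) * (- (real n * (inverse t ^ (n - 1) * (inverse t * inverse t))))) (at t)"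
    using greater by (auto intro!: derivative_eq_intros simp: algebra_simps)
  then have "((\<lambda>t. exp (- inverse t) * inverse t ^ n) has_real_derivative
      flat_exp (n + 2) t - real n * flat_exp (n + 1) t) (at t)"
    unfolding pow using greater by (simp add: flat_exp_def algebra_simps)
  then show ?thesis
    by (rule has_field_derivative_transform_within_open[where S = "{0<..}"])
      (use greater in \<open>auto simp: flat_exp_def\<close>)
qed

text \<open>A witness for the family demanded by \<open>smooth\<close>: an algebra generated by flat
  functions of a single affine coordinate, which contains the partial derivatives of its
  members.\<close>

inductive_set flat_algebra :: "fld set" where
  flat: "(\<lambda>x. flat_exp n (c * x $ i + d)) \<in> flat_algebra"
| const: "(\<lambda>x. c) \<in> flat_algebra"
| add: "f \<in> flat_algebra \<Longrightarrow> g \<in> flat_algebra \<Longrightarrow> (\<lambda>x. f x + g x) \<in> flat_algebra"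
| mult: "f \<in> flat_algebra \<Longrightarrow> g \<in> flat_algebra \<Longrightarrow> (\<lambda>x. f x * g x) \<in> flat_algebra"

lemma flat_algebra_gradient:
  assumes "f \<in> flat_algebra"
  shows "\<exists>d. (\<forall>x. GDERIV f x :> d x) \<and> (\<forall>i. (\<lambda>x. d x $ i) \<in> flat_algebra)"
  using assms
proof induction
  case (flat n c i d)
  let ?t = "\<lambda>x::pt. c * x $ i + d"
  \<comment> \<open>The derivative of the generator along coordinate \<open>i\<close>, with the
    difference written as a sum so that the introduction rules apply.\<close>
  let ?D = "\<lambda>x::pt. c * (flat_exp (n + 2) (?t x) + - real n * flat_exp (n + 1) (?t x))"
  have lin: "GDERIV ?t x :> c *\<^sub>R axis i 1" for x
    unfolding gderiv_def
    by (rule derivative_eq_intros refl bounded_linear.has_derivative[OF bounded_linear_vec_nth])+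
      (simp add: fun_eq_iff inner_axis mult.commute)
  have "GDERIV (\<lambda>x. flat_exp n (?t x)) x :> ?D x *\<^sub>R axis i 1" for x
    using GDERIV_DERIV_compose[OF lin DERIV_flat_exp, of n x] by (simp add: mult.commute)
  moreover have "(\<lambda>x. (?D x *\<^sub>R axis i 1) $ j) \<in> flat_algebra" for j
  proof -
    have "(\<lambda>x. ?D x * (axis i 1 :: pt) $ j) \<in> flat_algebra"
      by (intro flat_algebra.intros)
    then show ?thesis by simp
  qed
  ultimately show ?case by (intro exI[of _ "\<lambda>x. ?D x *\<^sub>R axis i 1"] conjI allI)
next
  case (const c)
  show ?case
    by (intro exI[of _ "\<lambda>x. 0"] conjI allI) (auto intro: GDERIV_const flat_algebra.const)
next
  case (add f g)
  then obtain df dg where d: "\<forall>x. GDERIV f x :> df x" "\<forall>i. (\<lambda>x. df x $ i) \<in> flat_algebra"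
    "\<forall>x. GDERIV g x :> dg x" "\<forall>i. (\<lambda>x. dg x $ i) \<in> flat_algebra" by blast
  then show ?case
    by (intro exI[of _ "\<lambda>x. df x + dg x"] conjI allI) (auto intro: GDERIV_add flat_algebra.add)
next
  case (mult f g)
  then obtain df dg where d: "\<forall>x. GDERIV f x :> df x" "\<forall>i. (\<lambda>x. df x $ i) \<in> flat_algebra"
    "\<forall>x. GDERIV g x :> dg x" "\<forall>i. (\<lambda>x. dg x $ i) \<in> flat_algebra" by blast
  show ?case
    by (intro exI[of _ "\<lambda>x. f x *\<^sub>R dg x + g x *\<^sub>R df x"] conjI allI)
      (auto intro!: GDERIV_mult flat_algebra.intros d[rule_format] mult.hyps)
qed

lemma smooth_flat_algebra: "f \<in> flat_algebra \<Longrightarrow> smooth f"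
  unfolding smooth_def using flat_algebra_gradient by blast

text \<open>Two one-sided cutoffs per coordinate, so for \<open>m > 0\<close> the product is
  positive exactly inside the box. The factor \<open>m\<close> sharpens them:
  \<open>exp (- 1 / (m * t))\<close> tends to \<open>1\<close> for each fixed
  \<open>t > 0\<close>.\<close>

definition box_bump :: "pt \<Rightarrow> pt \<Rightarrow> nat \<Rightarrow> fld" where
  "box_bump a b m x =
     (\<Prod>i\<in>UNIV. flat_exp 0 (real m * (x $ i - a $ i)) * flat_exp 0 (real m * (b $ i - x $ i)))"

lemma smooth_box_bump: "smooth (box_bump a b m)"
proof -
  have "(\<lambda>x. \<Prod>i\<in>I. flat_exp 0 (real m * (x $ i - a $ i)) * flat_exp 0 (real m * (b $ i - x $ i)))
      \<in> flat_algebra" if "finite I" for I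
    using that
  proof induction
    case empty
    show ?case using flat_algebra.const[of 1] by simp
  next
    case (insert i I)
    have "(\<lambda>x. flat_exp 0 (real m * x $ i + - (real m * a $ i))
        * flat_exp 0 (- real m * x $ i + real m * b $ i)) \<in> flat_algebra"
      by (intro flat_algebra.intros)
    then have "(\<lambda>x. flat_exp 0 (real m * (x $ i - a $ i)) * flat_exp 0 (real m * (b $ i - x $ i)))
        \<in> flat_algebra" by (simp add: algebra_simps)
    from flat_algebra.mult[OF this insert.IH] show ?case using insert.hyps by simp
  qed
  from this[of UNIV] show ?thesis
    by (intro smooth_flat_algebra) (simp add: box_bump_def[abs_def])
qed

lemma box_bump_outside: "x \<notin> box a b \<Longrightarrow> box_bump a b m x = 0"
  by (auto simp: box_bump_def mem_box_cart not_less flat_exp_def mult_le_0_iff)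

lemma box_bump_range: "0 \<le> box_bump a b m x" "box_bump a b m x \<le> 1"
  unfolding box_bump_def
  by (auto intro!: prod_nonneg prod_le_1 mult_nonneg_nonneg flat_exp_nonneg mult_le_one flat_exp_0_le_1)

lemma flat_exp_scaled_tendsto_1:
  assumes "t > 0"
  shows "(\<lambda>m. flat_exp 0 (real m * t)) \<longlonglongrightarrow> 1"
proof -
  have "(\<lambda>m. exp (- (inverse (real m) * inverse t))) \<longlonglongrightarrow> exp (- (0 * inverse t))"
    by (intro tendsto_intros lim_inverse_n)
  then have "(\<lambda>m. exp (- (inverse (real m) * inverse t))) \<longlonglongrightarrow> 1" by simp
  moreover have "eventually (\<lambda>m. exp (- (inverse (real m) * inverse t)) = flat_exp 0 (real m * t)) sequentially"
    using eventually_gt_at_top[of 0]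
    by eventually_elim (use assms in \<open>auto simp: flat_exp_def mult_le_0_iff\<close>)
  ultimately show ?thesis by (rule Lim_transform_eventually)
qed

lemma box_bump_tendsto: "(\<lambda>m. box_bump a b m x) \<longlonglongrightarrow> indicator (box a b) x"
proof (cases "x \<in> box a b")
  case True
  have "(\<lambda>m. box_bump a b m x) \<longlonglongrightarrow> (\<Prod>i\<in>(UNIV::3 set). 1 * 1)"
    unfolding box_bump_def
    by (intro tendsto_prod tendsto_mult flat_exp_scaled_tendsto_1) (use True in \<open>auto simp: mem_box_cart\<close>)
  then show ?thesis using True by simp
qed (simp add: box_bump_outside)

lemma test_fun_box_bump: "cbox a b \<subseteq> \<Omega> \<Longrightarrow> test_fun \<Omega> (box_bump a b m)"
  unfolding test_fun_def
  using smooth_box_bump box_bump_outside box_subset_cbox[of a b] by (meson compact_cbox subset_iff)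

section \<open>Continuity and integrability of test functions and their partial derivatives\<close>

lemma GDERIV_imp_continuous_on: "(\<And>x. GDERIV f x :> d x) \<Longrightarrow> continuous_on UNIV f"
  by (meson continuous_at_imp_continuous_on gderiv_def has_derivative_continuous)

text \<open>The family in the definition of \<open>smooth\<close> contains each partial derivative,
  which is therefore itself differentiable and so continuous.\<close>

lemma smooth_partial:
  assumes "smooth f"
  shows "continuous_on UNIV f" "continuous_on UNIV (\<lambda>x. frechet_derivative f (at x) (axis i 1))"
proof -
  obtain G where G: "f \<in> G"
    "\<And>g. g \<in> G \<Longrightarrow> \<exists>d. (\<forall>x. GDERIV g x :> d x) \<and> (\<forall>i. (\<lambda>x. d x $ i) \<in> G)"
    using assms unfolding smooth_def by blast
  obtain d where d: "\<And>x. GDERIV f x :> d x" "\<And>i. (\<lambda>x. d x $ i) \<in> G" using G by meson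
  obtain e where e: "\<And>x. GDERIV (\<lambda>x. d x $ i) x :> e x" using G(2)[OF d(2)[of i]] by blast
  show "continuous_on UNIV f" using d(1) by (rule GDERIV_imp_continuous_on)
  have "frechet_derivative f (at x) = (\<lambda>h. inner h (d x))" for x
    using d(1)[of x] unfolding gderiv_def by (metis frechet_derivative_at)
  then show "continuous_on UNIV (\<lambda>x. frechet_derivative f (at x) (axis i 1))"
    using GDERIV_imp_continuous_on[OF e] by (simp add: inner_axis')
qed

lemma indicator_L2:
  assumes "S \<in> lmeasurable" "\<Omega> \<in> sets lebesgue"
  shows "(indicator S :: fld) \<in> L2 \<Omega>"
proof -
  have "S \<inter> \<Omega> \<in> lmeasurable" using assms by (rule fmeasurable_Int_fmeasurable)
  then have "integrable lebesgue (indicator (\<Omega> \<inter> S) :: fld)"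
    by (intro integrable_real_indicator) (auto simp: fmeasurable_def Int_commute)
  moreover have "indicator (\<Omega> \<inter> S) = (\<lambda>x. indicator \<Omega> x *\<^sub>R indicator S x :: real)"
    by (simp add: fun_eq_iff indicator_inter_arith)
  ultimately have "integrable (lebesgue_on \<Omega>) (indicator S :: fld)"
    using assms(2) by (subst integrable_restrict_space) auto
  moreover have "(\<lambda>x. (indicator S x :: real)\<^sup>2) = indicator S"
    by (auto simp: indicator_def)
  ultimately show ?thesis by (simp add: L2_def borel_measurable_integrable)
qed

lemma compact_support_L2:
  assumes "continuous_on UNIV f" "compact K" "\<And>x. x \<notin> K \<Longrightarrow> f x = 0" "\<Omega> \<in> sets lebesgue"
  shows "f \<in> L2 \<Omega>"
proof -
  have meas: "f \<in> borel_measurable (lebesgue_on \<Omega>)"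
    using continuous_imp_measurable_on_sets_lebesgue[OF continuous_on_subset[OF assms(1)] assms(4)] by simp
  have "compact (f ` K)" using assms continuous_on_subset compact_continuous_image by blast
  then obtain B where B: "\<bar>f x\<bar> \<le> B" if "x \<in> K" for x
    using compact_imp_bounded[of "f ` K"] unfolding bounded_iff by auto
  have "integrable (lebesgue_on \<Omega>) (\<lambda>x. indicator K x * indicator K x :: real)"
    using assms by (intro L2_integrable_mult indicator_L2 lmeasurable_compact)
  then have "integrable (lebesgue_on \<Omega>) (\<lambda>x. B\<^sup>2 * indicator K x)"
    by (simp flip: indicator_inter_arith)
  then have "integrable (lebesgue_on \<Omega>) (\<lambda>x. (f x)\<^sup>2)"
  proof (rule Bochner_Integration.integrable_bound)
    show "(\<lambda>x. (f x)\<^sup>2) \<in> borel_measurable (lebesgue_on \<Omega>)" using meas by simp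
    have "(f x)\<^sup>2 \<le> B\<^sup>2 * indicator K x" for x
      using B[of x] assms(3)[of x] by (cases "x \<in> K") (auto simp: abs_le_square_iff[symmetric])
    then show "AE x in lebesgue_on \<Omega>. norm ((f x)\<^sup>2) \<le> norm (B\<^sup>2 * indicator K x)" by simp
  qed
  with meas show ?thesis by (simp add: L2_def)
qed

lemma test_fun_L2:
  assumes "test_fun \<Omega> \<psi>" "\<Omega> \<in> sets lebesgue"
  shows "\<psi> \<in> L2 \<Omega>" "(\<lambda>x. frechet_derivative \<psi> (at x) (axis i 1)) \<in> L2 \<Omega>"
proof -
  obtain K where K: "compact K" "\<And>x. x \<notin> K \<Longrightarrow> \<psi> x = 0" and sm: "smooth \<psi>"
    using assms unfolding test_fun_def by blast
  \<comment> \<open>The complement of the compact \<open>K\<close> is open, so \<open>\<psi>\<close>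
    vanishes near \<open>x\<close> and not only at \<open>x\<close>.\<close>
  have "frechet_derivative \<psi> (at x) (axis i 1) = 0" if "x \<notin> K" for x
  proof -
    have "((\<lambda>x. 0) has_derivative (\<lambda>h. 0)) (at x)" by simp
    then have "(\<psi> has_derivative (\<lambda>h. 0)) (at x)"
      by (rule has_derivative_transform_within_open[where s = "- K"])
        (use that K in \<open>auto simp: compact_imp_closed open_Compl\<close>)
    then show ?thesis by (metis frechet_derivative_at)
  qed
  then show "\<psi> \<in> L2 \<Omega>" "(\<lambda>x. frechet_derivative \<psi> (at x) (axis i 1)) \<in> L2 \<Omega>"
    using smooth_partial[OF sm] K assms(2) compact_support_L2[of _ K] by blast+
qed

text \<open>The bumps converge boundedly to the indicator of a box, so \<open>g\<close> has mean zero over every small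
  box, and the claim follows by Lebesgue differentiation.\<close>

lemma fundamental_lemma_variations:
  assumes "open \<Omega>" and g: "g \<in> L2 \<Omega>" and zero: "\<And>\<psi>. test_fun \<Omega> \<psi> \<Longrightarrow> ipH \<Omega> g \<psi> = 0"
  shows "AE x in lebesgue_on \<Omega>. g x = 0"
proof -
  have \<Omega>: "\<Omega> \<in> sets lebesgue" using \<open>open \<Omega>\<close> by simp
  \<comment> \<open>Lebesgue differentiation is applied to a function on all of space, hence the
    extension by zero.\<close>
  define f where "f x = (if x \<in> \<Omega> then g x else 0)" for x
  have box0: "(\<integral>x. g x * indicator (box a b) x \<partial>lebesgue_on \<Omega>) = 0" if ab: "cbox a b \<subseteq> \<Omega>" for a b
  proof -
    have "(\<lambda>m. \<integral>x. g x * box_bump a b m x \<partial>lebesgue_on \<Omega>)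
        \<longlonglongrightarrow> (\<integral>x. g x * indicator (box a b) x \<partial>lebesgue_on \<Omega>)"
    proof (rule integral_dominated_convergence)
      show "(\<lambda>x. g x * indicator (box a b) x) \<in> borel_measurable (lebesgue_on \<Omega>)"
        using L2_measurable[OF g] L2_measurable[OF indicator_L2[OF lmeasurable_box \<Omega>]]
        by (rule borel_measurable_times)
      show "(\<lambda>x. g x * box_bump a b m x) \<in> borel_measurable (lebesgue_on \<Omega>)" for m
        using L2_measurable[OF g] L2_measurable[OF test_fun_L2(1)[OF test_fun_box_bump[OF ab] \<Omega>]]
        by (rule borel_measurable_times)
      \<comment> \<open>The dominating function: all bumps lie below the indicator of the closed
        box, which is square integrable.\<close>
      show "integrable (lebesgue_on \<Omega>) (\<lambda>x. \<bar>g x * indicator (cbox a b) x\<bar>)"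
        by (intro integrable_abs L2_integrable_mult g indicator_L2 lmeasurable_cbox \<Omega>)
      show "AE x in lebesgue_on \<Omega>. (\<lambda>m. g x * box_bump a b m x) \<longlonglongrightarrow> g x * indicator (box a b) x"
        by (intro AE_I2 tendsto_mult tendsto_const box_bump_tendsto)
      have "\<bar>box_bump a b m x\<bar> \<le> indicator (cbox a b) x" for m x
        using box_bump_range[of a b m x] box_bump_outside[of x a b m] box_subset_cbox[of a b]
        by (auto simp: indicator_def)
      then show "AE x in lebesgue_on \<Omega>. norm (g x * box_bump a b m x) \<le> \<bar>g x * indicator (cbox a b) x\<bar>" for m
        by (auto simp: abs_mult intro!: mult_left_mono)
    qed
    moreover have "(\<integral>x. g x * box_bump a b m x \<partial>lebesgue_on \<Omega>) = 0" for m
      using zero[OF test_fun_box_bump[OF ab]] by (simp add: ipH_def)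
    ultimately show ?thesis by (simp add: LIMSEQ_const_iff)
  qed
  have f_box: "integrable (lebesgue_on (box a b)) f"
      "integral (box a b) f = (\<integral>x. g x * indicator (box a b) x \<partial>lebesgue_on \<Omega>)" for a b
  proof -
    have "integrable (lebesgue_on \<Omega>) (\<lambda>x. g x * indicator (box a b) x)"
      by (intro L2_integrable_mult g indicator_L2 lmeasurable_box \<Omega>)
    then have "integrable lebesgue (\<lambda>x. indicator \<Omega> x *\<^sub>R (g x * indicator (box a b) x))"
      using \<Omega> by (subst (asm) integrable_restrict_space) auto
    moreover have eq: "indicator \<Omega> x *\<^sub>R (g x * indicator (box a b) x) = indicator (box a b) x *\<^sub>R f x" for x
      by (auto simp: f_def indicator_def)
    ultimately have "integrable lebesgue (\<lambda>x. indicator (box a b) x *\<^sub>R f x)" by (simp only: eq)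
    then show int: "integrable (lebesgue_on (box a b)) f"
      by (subst integrable_restrict_space) auto
    have "integral (box a b) f = (\<integral>x. f x \<partial>lebesgue_on (box a b))"
      using lebesgue_integral_eq_integral[OF int] by simp
    also have "\<dots> = (\<integral>x. indicator \<Omega> x *\<^sub>R (g x * indicator (box a b) x) \<partial>lebesgue)"
      unfolding eq by (rule integral_restrict_space) auto
    also have "\<dots> = (\<integral>x. g x * indicator (box a b) x \<partial>lebesgue_on \<Omega>)"
      using \<Omega> by (intro integral_restrict_space[symmetric]) auto
    finally show "integral (box a b) f = (\<integral>x. g x * indicator (box a b) x \<partial>lebesgue_on \<Omega>)" .
  qed
  have "f integrable_on cbox a b" for a b
    using integrable_on_lebesgue_on[OF f_box(1)[of a b]] by (simp add: integrable_on_open_interval)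
  \<comment> \<open>Off the null set \<open>N\<close>, averages over cubes with lower corner
    \<open>x\<close> converge to \<open>f x\<close>.\<close>
  then obtain N where N: "negligible N" and
    lim: "\<And>x e. x \<notin> N \<Longrightarrow> 0 < e \<Longrightarrow> \<exists>d>0. \<forall>h. 0 < h \<and> h < d \<longrightarrow>
        norm (integral (cbox x (x + h *\<^sub>R One)) f /\<^sub>R h ^ DIM(pt) - f x) < e"
    using integrable_ccontinuous_explicit[of f] by blast
  have "g x = 0" if x: "x \<in> \<Omega>" "x \<notin> N" for x
  proof (rule ccontr)
    assume "g x \<noteq> 0"
    \<comment> \<open>With the tolerance \<open>\<bar>g x\<bar>\<close>, a small cube of mean zero
      is a contradiction: it misses \<open>f x = g x\<close> by exactly that amount.\<close>
    then obtain d where d: "d > 0" "\<And>h. 0 < h \<Longrightarrow> h < d \<Longrightarrow>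
        norm (integral (cbox x (x + h *\<^sub>R One)) f /\<^sub>R h ^ DIM(pt) - f x) < \<bar>g x\<bar>"
      using lim[OF x(2), of "\<bar>g x\<bar>"] by auto
    obtain a b where ab: "x \<in> box a b" "cbox a b \<subseteq> \<Omega>"
      using \<open>open \<Omega>\<close> x(1) open_contains_cbox by metis
    have "((\<lambda>h. x + h *\<^sub>R One) \<longlongrightarrow> x + 0 *\<^sub>R One) (at_right 0)" by (intro tendsto_intros)
    then have "eventually (\<lambda>h. x + h *\<^sub>R One \<in> box a b) (at_right 0)"
      by (rule topological_tendstoD) (use ab in auto)
    moreover have "eventually (\<lambda>h. h < d) (at_right 0)" "eventually (\<lambda>h. 0 < h) (at_right (0::real))"
      using d(1) by (auto simp: eventually_at_right_less intro: order_tendstoD(2)[OF tendsto_ident_at])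
    ultimately have "eventually (\<lambda>h. x + h *\<^sub>R One \<in> box a b \<and> h < d \<and> 0 < h) (at_right 0)"
      by eventually_elim simp
    then obtain h where h: "x + h *\<^sub>R One \<in> box a b" "h < d" "0 < h"
      using eventually_happens'[OF trivial_limit_at_right_real] by blast
    have "cbox x (x + h *\<^sub>R One) \<subseteq> cbox a b"
      using ab(1) h(1) by (auto simp: subset_box mem_box less_imp_le)
    then have "integral (cbox x (x + h *\<^sub>R One)) f = 0"
      using box0 f_box(2) ab(2) by (metis integral_open_interval subset_trans)
    then show False using d(2)[OF h(3,2)] x(1) by (simp add: f_def)
  qed
  moreover have "AE x in lebesgue. x \<notin> N"
    using N by (simp add: negligible_iff_null_sets AE_not_in)
  ultimately have "AE x in lebesgue. x \<in> \<Omega> \<longrightarrow> g x = 0"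
    by (auto elim: eventually_mono)
  then show ?thesis using \<Omega> by (subst AE_restrict_space_iff) auto
qed


subsection \<open>Weak derivatives and the Neumann Laplacian\<close>

lemma L2_comb: "u \<in> L2 \<Omega> \<Longrightarrow> v \<in> L2 \<Omega> \<Longrightarrow> (\<lambda>x. a * u x + b * v x) \<in> L2 \<Omega>"
  by (intro L2_add L2_scale)

lemma ipH_comb_left:
  assumes "u \<in> L2 \<Omega>" "v \<in> L2 \<Omega>" "w \<in> L2 \<Omega>"
  shows "ipH \<Omega> (\<lambda>x. a * u x + b * v x) w = a * ipH \<Omega> u w + b * ipH \<Omega> v w"
  using assms by (simp add: ipH_add_left L2_scale ipH_scale_left)

lemma weak_grad_L2: "weak_grad \<Omega> u g \<Longrightarrow> (\<lambda>x. g x $ i) \<in> L2 \<Omega>"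
  by (simp add: weak_grad_def)

lemma weak_grad_unique:
  assumes "open \<Omega>" "weak_grad \<Omega> u g" "weak_grad \<Omega> u h"
  shows "AE x in lebesgue_on \<Omega>. g x = h x"
proof -
  have \<Omega>: "\<Omega> \<in> sets lebesgue" using \<open>open \<Omega>\<close> by simp
  have "AE x in lebesgue_on \<Omega>. g x $ i = h x $ i" for i
  proof -
    have gh: "(\<lambda>x. g x $ i) \<in> L2 \<Omega>" "(\<lambda>x. h x $ i) \<in> L2 \<Omega>"
      using assms by (auto intro: weak_grad_L2)
    have "AE x in lebesgue_on \<Omega>. 1 * g x $ i + - 1 * h x $ i = 0"
    proof (rule fundamental_lemma_variations[OF \<open>open \<Omega>\<close> L2_comb[OF gh]])
      fix \<psi> assume \<psi>: "test_fun \<Omega> \<psi>"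
      have "ipH \<Omega> (\<lambda>x. g x $ i) \<psi> = ipH \<Omega> (\<lambda>x. h x $ i) \<psi>"
        using assms \<psi> unfolding weak_grad_def by (metis neg_equal_iff_equal)
      then show "ipH \<Omega> (\<lambda>x. 1 * g x $ i + - 1 * h x $ i) \<psi> = 0"
        unfolding ipH_comb_left[OF gh test_fun_L2(1)[OF \<psi> \<Omega>]] by simp
    qed
    then show ?thesis by simp
  qed
  then have "AE x in lebesgue_on \<Omega>. \<forall>i. g x $ i = h x $ i"
    by (simp add: AE_all_countable)
  then show ?thesis by (simp add: vec_eq_iff)
qed

lemma weak_grad_comb:
  assumes "\<Omega> \<in> sets lebesgue" "u \<in> L2 \<Omega>" "v \<in> L2 \<Omega>" "weak_grad \<Omega> u g" "weak_grad \<Omega> v h"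
  shows "weak_grad \<Omega> (\<lambda>x. a * u x + b * v x) (\<lambda>x. a *\<^sub>R g x + b *\<^sub>R h x)"
proof -
  have L: "(\<lambda>x. g x $ i) \<in> L2 \<Omega>" "(\<lambda>x. h x $ i) \<in> L2 \<Omega>" for i
    using assms by (auto intro: weak_grad_L2)
  show ?thesis
    unfolding weak_grad_def
  proof (intro conjI allI impI)
    show "(\<lambda>x. (a *\<^sub>R g x + b *\<^sub>R h x) $ i) \<in> L2 \<Omega>" for i
      using L2_comb[OF L] by simp
    fix \<psi> i assume \<psi>: "test_fun \<Omega> \<psi>"
    have "ipH \<Omega> u (\<lambda>x. frechet_derivative \<psi> (at x) (axis i 1)) = - ipH \<Omega> (\<lambda>x. g x $ i) \<psi>"
      "ipH \<Omega> v (\<lambda>x. frechet_derivative \<psi> (at x) (axis i 1)) = - ipH \<Omega> (\<lambda>x. h x $ i) \<psi>"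
      using assms \<psi> unfolding weak_grad_def by blast+
    then show "ipH \<Omega> (\<lambda>x. a * u x + b * v x) (\<lambda>x. frechet_derivative \<psi> (at x) (axis i 1))
        = - ipH \<Omega> (\<lambda>x. (a *\<^sub>R g x + b *\<^sub>R h x) $ i) \<psi>"
      using test_fun_L2[OF \<psi> \<open>\<Omega> \<in> sets lebesgue\<close>] assms L by (simp add: ipH_comb_left)
  qed
qed

text \<open>The two predicates coincide, so \<open>SOME\<close> picks the very same gradient for
  both functions. Hence \<open>H1_cong_AE\<close> can conclude with an equation for
  \<open>wgrad\<close> that holds everywhere.\<close>

lemma weak_grad_cong_AE:
  assumes "\<Omega> \<in> sets lebesgue" "u \<in> L2 \<Omega>" "v \<in> L2 \<Omega>" "AE x in lebesgue_on \<Omega>. u x = v x"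
  shows "weak_grad \<Omega> u = weak_grad \<Omega> v"
proof -
  have "ipH \<Omega> u (\<lambda>x. frechet_derivative \<psi> (at x) (axis i 1))
      = ipH \<Omega> v (\<lambda>x. frechet_derivative \<psi> (at x) (axis i 1))" if "test_fun \<Omega> \<psi>" for \<psi> i
    using assms test_fun_L2(2)[OF that assms(1)] by (intro ipH_cong_AE)
  then show ?thesis by (auto simp: weak_grad_def fun_eq_iff)
qed

lemma H1_L2: "u \<in> H1 \<Omega> \<Longrightarrow> u \<in> L2 \<Omega>"
  by (simp add: H1_def)

lemma weak_grad_wgrad: "u \<in> H1 \<Omega> \<Longrightarrow> weak_grad \<Omega> u (wgrad \<Omega> u)"
  unfolding H1_def wgrad_def by (metis (mono_tags, lifting) mem_Collect_eq someI_ex)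

lemma wgrad_L2: "u \<in> H1 \<Omega> \<Longrightarrow> (\<lambda>x. wgrad \<Omega> u x $ i) \<in> L2 \<Omega>"
  using weak_grad_wgrad weak_grad_L2 by blast

text \<open>The gradient chosen for a combination is merely one of its weak gradients, so it agrees
  with the combination of the chosen gradients only almost everywhere.\<close>

lemma H1_comb:
  assumes "open \<Omega>" "u \<in> H1 \<Omega>" "v \<in> H1 \<Omega>"
  shows "(\<lambda>x. a * u x + b * v x) \<in> H1 \<Omega>"
    "AE x in lebesgue_on \<Omega>. wgrad \<Omega> (\<lambda>x. a * u x + b * v x) x = a *\<^sub>R wgrad \<Omega> u x + b *\<^sub>R wgrad \<Omega> v x"
proof -
  have wg: "weak_grad \<Omega> (\<lambda>x. a * u x + b * v x) (\<lambda>x. a *\<^sub>R wgrad \<Omega> u x + b *\<^sub>R wgrad \<Omega> v x)"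
    using assms by (intro weak_grad_comb weak_grad_wgrad H1_L2) auto
  then show *: "(\<lambda>x. a * u x + b * v x) \<in> H1 \<Omega>"
    using L2_comb[OF H1_L2[OF assms(2)] H1_L2[OF assms(3)]] unfolding H1_def by blast
  show "AE x in lebesgue_on \<Omega>. wgrad \<Omega> (\<lambda>x. a * u x + b * v x) x = a *\<^sub>R wgrad \<Omega> u x + b *\<^sub>R wgrad \<Omega> v x"
    by (rule weak_grad_unique[OF \<open>open \<Omega>\<close> weak_grad_wgrad[OF *] wg])
qed

lemma H1_cong_AE:
  assumes "\<Omega> \<in> sets lebesgue" "u \<in> H1 \<Omega>" "v \<in> L2 \<Omega>" "AE x in lebesgue_on \<Omega>. u x = v x"
  shows "v \<in> H1 \<Omega>" "wgrad \<Omega> v = wgrad \<Omega> u"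
  using weak_grad_cong_AE[OF assms(1) H1_L2[OF assms(2)] assms(3,4)] assms(2,3)
  by (auto simp: H1_def wgrad_def)

lemma H2_H1: "u \<in> H2 \<Omega> \<Longrightarrow> u \<in> H1 \<Omega>" "u \<in> H2 \<Omega> \<Longrightarrow> (\<lambda>x. wgrad \<Omega> u x $ i) \<in> H1 \<Omega>"
  by (auto simp: H2_def)

lemma wlap_L2:
  assumes "u \<in> H2 \<Omega>"
  shows "wlap \<Omega> u \<in> L2 \<Omega>"
  using L2_lincomb[of UNIV "\<lambda>i x. wgrad \<Omega> (\<lambda>y. wgrad \<Omega> u y $ i) x $ i" \<Omega> "\<lambda>_. 1"]
    wgrad_L2[OF H2_H1(2)[OF assms]] by (simp add: wlap_def[abs_def])

lemma H2_comb:
  assumes "open \<Omega>" "u \<in> H2 \<Omega>" "v \<in> H2 \<Omega>"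
  shows "(\<lambda>x. a * u x + b * v x) \<in> H2 \<Omega>"
    "AE x in lebesgue_on \<Omega>. wlap \<Omega> (\<lambda>x. a * u x + b * v x) x = a * wlap \<Omega> u x + b * wlap \<Omega> v x"
proof -
  let ?w = "\<lambda>x. a * u x + b * v x"
  have \<Omega>: "\<Omega> \<in> sets lebesgue" using \<open>open \<Omega>\<close> by simp
  have w: "?w \<in> H1 \<Omega>" and
    g: "AE x in lebesgue_on \<Omega>. wgrad \<Omega> ?w x = a *\<^sub>R wgrad \<Omega> u x + b *\<^sub>R wgrad \<Omega> v x"
    using H1_comb[OF assms(1) H2_H1(1)[OF assms(2)] H2_H1(1)[OF assms(3)]] by auto
  \<comment> \<open>Second derivatives are taken of the chosen gradient of \<open>?w\<close>, whose
    components equal the combination only almost everywhere; \<open>H1_cong_AE\<close> carries both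
    membership and gradient across.\<close>
  have comp: "(\<lambda>x. wgrad \<Omega> ?w x $ i) \<in> H1 \<Omega> \<and> (AE x in lebesgue_on \<Omega>.
      wgrad \<Omega> (\<lambda>x. wgrad \<Omega> ?w x $ i) x
        = a *\<^sub>R wgrad \<Omega> (\<lambda>x. wgrad \<Omega> u x $ i) x + b *\<^sub>R wgrad \<Omega> (\<lambda>x. wgrad \<Omega> v x $ i) x)" for i
  proof -
    note c = H1_comb[OF assms(1) H2_H1(2)[OF assms(2)] H2_H1(2)[OF assms(3)], of a i b i]
    have "AE x in lebesgue_on \<Omega>. a * wgrad \<Omega> u x $ i + b * wgrad \<Omega> v x $ i = wgrad \<Omega> ?w x $ i"
      using g by eventually_elim simp
    from H1_cong_AE[OF \<Omega> c(1) wgrad_L2[OF w] this] c(2) show ?thesis by simp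
  qed
  then show "?w \<in> H2 \<Omega>" using w by (simp add: H2_def)
  have "AE x in lebesgue_on \<Omega>. \<forall>i. wgrad \<Omega> (\<lambda>x. wgrad \<Omega> ?w x $ i) x
      = a *\<^sub>R wgrad \<Omega> (\<lambda>x. wgrad \<Omega> u x $ i) x + b *\<^sub>R wgrad \<Omega> (\<lambda>x. wgrad \<Omega> v x $ i) x"
    using comp by (simp add: AE_all_countable)
  then show "AE x in lebesgue_on \<Omega>. wlap \<Omega> ?w x = a * wlap \<Omega> u x + b * wlap \<Omega> v x"
    by eventually_elim (simp add: wlap_def sum.distrib sum_distrib_left)
qed

section \<open>Green's formula and the Neumann condition\<close>

lemma normal_deriv_eq:
  assumes "u \<in> H2 \<Omega>" "v \<in> H1 \<Omega>"
  shows "normal_deriv \<Omega> u v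
    = ipH \<Omega> (wlap \<Omega> u) v + (\<Sum>i\<in>UNIV. ipH \<Omega> (\<lambda>x. wgrad \<Omega> u x $ i) (\<lambda>x. wgrad \<Omega> v x $ i))"
  using assms
  by (simp add: normal_deriv_def ipH_def inner_vec_def L2_integrable_mult wlap_L2 H1_L2 wgrad_L2 H2_H1)

lemma DA_H2: "u \<in> DA \<Omega> \<Longrightarrow> u \<in> H2 \<Omega>"
  by (simp add: DA_def)

lemma DA_comb:
  assumes "open \<Omega>" "u \<in> DA \<Omega>" "v \<in> DA \<Omega>"
  shows "(\<lambda>x. a * u x + b * v x) \<in> DA \<Omega>"
proof -
  let ?w = "\<lambda>x. a * u x + b * v x"
  have u: "u \<in> H2 \<Omega>" and v: "v \<in> H2 \<Omega>" using assms by (auto simp: DA_H2)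
  have w: "?w \<in> H2 \<Omega>" by (rule H2_comb(1)[OF assms(1) u v])
  have "normal_deriv \<Omega> ?w f = 0" if f: "f \<in> H1 \<Omega>" for f
  proof -
    have "ipH \<Omega> (wlap \<Omega> ?w) f = a * ipH \<Omega> (wlap \<Omega> u) f + b * ipH \<Omega> (wlap \<Omega> v) f"
      unfolding ipH_comb_left[OF wlap_L2[OF u] wlap_L2[OF v] H1_L2[OF f], symmetric]
      by (intro ipH_cong_AE wlap_L2 w L2_comb u v H1_L2 f H2_comb(2) assms)
    moreover have "ipH \<Omega> (\<lambda>x. wgrad \<Omega> ?w x $ i) (\<lambda>x. wgrad \<Omega> f x $ i)
        = a * ipH \<Omega> (\<lambda>x. wgrad \<Omega> u x $ i) (\<lambda>x. wgrad \<Omega> f x $ i)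
        + b * ipH \<Omega> (\<lambda>x. wgrad \<Omega> v x $ i) (\<lambda>x. wgrad \<Omega> f x $ i)" for i
      unfolding ipH_comb_left[OF wgrad_L2[OF H2_H1(1)[OF u]] wgrad_L2[OF H2_H1(1)[OF v]] wgrad_L2[OF f], symmetric]
    proof (intro ipH_cong_AE wgrad_L2 L2_comb H2_H1(1)[OF u] H2_H1(1)[OF v] H2_H1(1)[OF w] f)
      show "AE x in lebesgue_on \<Omega>. wgrad \<Omega> ?w x $ i = a * wgrad \<Omega> u x $ i + b * wgrad \<Omega> v x $ i"
        using H1_comb(2)[OF assms(1) H2_H1(1)[OF u] H2_H1(1)[OF v], of a b] by eventually_elim simp
    qed
    ultimately have "normal_deriv \<Omega> ?w f = a * normal_deriv \<Omega> u f + b * normal_deriv \<Omega> v f"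
      by (simp add: normal_deriv_eq w u v f sum.distrib sum_distrib_left algebra_simps)
    then show ?thesis using assms f by (simp add: DA_def)
  qed
  then show ?thesis using w by (simp add: DA_def)
qed

lemma A0_L2: "u \<in> DA \<Omega> \<Longrightarrow> A0 \<Omega> \<kappa> u \<in> L2 \<Omega>"
  unfolding A0_def by (intro L2_scale wlap_L2 DA_H2)

lemma DA_H1: "u \<in> DA \<Omega> \<Longrightarrow> u \<in> H1 \<Omega>"
  by (simp add: DA_H2 H2_H1)

lemma DA_L2: "u \<in> DA \<Omega> \<Longrightarrow> u \<in> L2 \<Omega>"
  by (simp add: DA_H1 H1_L2)

text \<open>The vanishing of \<open>normal_deriv\<close> is Green's formula without boundary term.
  The resulting form is symmetric in its arguments and, for \<open>\<kappa> > 0\<close>, nonpositive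
  on equal ones; the next two lemmas draw these conclusions.\<close>

lemma ipH_A0:
  assumes "u \<in> DA \<Omega>" "v \<in> H1 \<Omega>"
  shows "ipH \<Omega> (A0 \<Omega> \<kappa> u) v
    = - \<kappa> * (\<Sum>i\<in>UNIV. ipH \<Omega> (\<lambda>x. wgrad \<Omega> u x $ i) (\<lambda>x. wgrad \<Omega> v x $ i))"
proof -
  have "normal_deriv \<Omega> u v = 0" using assms by (simp add: DA_def)
  then have "ipH \<Omega> (wlap \<Omega> u) v = - (\<Sum>i\<in>UNIV. ipH \<Omega> (\<lambda>x. wgrad \<Omega> u x $ i) (\<lambda>x. wgrad \<Omega> v x $ i))"
    using normal_deriv_eq[OF DA_H2[OF assms(1)] assms(2)] by simp
  then show ?thesis by (simp add: A0_def ipH_scale_left)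
qed

lemma A0_symmetric:
  assumes "u \<in> DA \<Omega>" "v \<in> DA \<Omega>"
  shows "ipH \<Omega> (A0 \<Omega> \<kappa> u) v = ipH \<Omega> u (A0 \<Omega> \<kappa> v)"
proof -
  have "ipH \<Omega> (A0 \<Omega> \<kappa> u) v = ipH \<Omega> (A0 \<Omega> \<kappa> v) u"
    unfolding ipH_A0[OF assms(1) DA_H1[OF assms(2)]] ipH_A0[OF assms(2) DA_H1[OF assms(1)]]
    by (simp add: ipH_commute)
  then show ?thesis by (simp add: ipH_commute)
qed

lemma A0_dissipative:
  assumes "u \<in> DA \<Omega>" "\<kappa> > 0"
  shows "ipH \<Omega> (A0 \<Omega> \<kappa> u) u \<le> 0"
  using assms unfolding ipH_A0[OF assms(1) DA_H1[OF assms(1)]]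
  by (simp add: sum_nonneg ipH_self_nonneg)

text \<open>Expanding the square of \<open>u - A0 u\<close> leaves the cross term
  \<open>- 2 * ipH \<Omega> (A0 \<Omega> \<kappa> u) u\<close>, which is nonnegative by
  dissipativity. This makes the pivot embedding into the dual of \<open>DA\<close> bounded.\<close>

lemma normH_le_normDA:
  assumes "u \<in> DA \<Omega>" "\<kappa> > 0"
  shows "normH \<Omega> u \<le> normDA \<Omega> \<kappa> u"
proof -
  let ?A = "A0 \<Omega> \<kappa> u"
  let ?d = "\<lambda>x. 1 * u x + - 1 * ?A x"
  note u = DA_L2[OF assms(1)] and A = A0_L2[OF assms(1), of \<kappa>]
  have "ipH \<Omega> ?d ?d = ipH \<Omega> u ?d - ipH \<Omega> ?A ?d"
    unfolding ipH_comb_left[OF u A L2_comb[OF u A]] by simp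
  also have "\<dots> = ipH \<Omega> u u - 2 * ipH \<Omega> ?A u + ipH \<Omega> ?A ?A"
    unfolding ipH_commute[of \<Omega> _ ?d] ipH_comb_left[OF u A u] ipH_comb_left[OF u A A]
    by (simp add: ipH_commute)
  also have "\<dots> \<ge> ipH \<Omega> u u"
    using A0_dissipative[OF assms] ipH_self_nonneg[of \<Omega> ?A] by simp
  finally show ?thesis by (simp add: normDA_def opA_def normH_def)
qed

section \<open>Carriers as subspaces and the pivot embedding\<close>

lemma normH_le_normV: "\<kappa> > 0 \<Longrightarrow> normH \<Omega> u \<le> normV \<Omega> \<kappa> u"
  unfolding normV_def by (rule real_le_rsqrt) simp

lemma zero_H1: "0 \<in> H1 \<Omega>"
proof -
  have "0 \<in> L2 \<Omega>" by (rule fun_vs.subspace_0[OF subspace_L2])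
  moreover have "weak_grad \<Omega> 0 (\<lambda>x. 0)"
    using calculation by (simp add: weak_grad_def ipH_def zero_fun_def)
  ultimately show ?thesis unfolding H1_def by blast
qed

lemma subspace_H1: "open \<Omega> \<Longrightarrow> fun_vs.subspace (H1 \<Omega>)"
  unfolding fun_vs.subspace_def plus_fun_def
  using zero_H1 H1_comb(1)[of \<Omega> _ _ 1 1] H1_comb(1)[of \<Omega> _ _ _ 0] by auto

text \<open>The gradient chosen for \<open>0\<close> is known to vanish only almost everywhere; the
  combination rule with both coefficients \<open>0\<close> yields this.\<close>

lemma zero_H2:
  assumes "open \<Omega>"
  shows "0 \<in> H2 \<Omega>"
proof -
  have \<Omega>: "\<Omega> \<in> sets lebesgue" using assms by simp
  have "AE x in lebesgue_on \<Omega>. wgrad \<Omega> 0 x = 0"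
    using H1_comb(2)[OF assms zero_H1 zero_H1, of 0 0] by (simp add: zero_fun_def)
  then have "AE x in lebesgue_on \<Omega>. (0 :: fld) x = wgrad \<Omega> 0 x $ i" for i
    by eventually_elim simp
  then show ?thesis
    using H1_cong_AE(1)[OF \<Omega> zero_H1 wgrad_L2[OF zero_H1]] zero_H1 by (simp add: H2_def)
qed

lemma subspace_DA:
  assumes "open \<Omega>"
  shows "fun_vs.subspace (DA \<Omega>)"
proof -
  have "normal_deriv \<Omega> 0 v = 0" if v: "v \<in> H1 \<Omega>" for v
  proof -
    have "AE x in lebesgue_on \<Omega>. wlap \<Omega> 0 x = 0" "AE x in lebesgue_on \<Omega>. wgrad \<Omega> 0 x = 0"
      using H2_comb(2)[OF assms zero_H2[OF assms] zero_H2[OF assms], of 0 0]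
        H1_comb(2)[OF assms zero_H1 zero_H1, of 0 0] by (simp_all add: zero_fun_def)
    then have "AE x in lebesgue_on \<Omega>. wlap \<Omega> 0 x * v x + wgrad \<Omega> 0 x \<bullet> wgrad \<Omega> v x = 0"
      by eventually_elim simp
    then show ?thesis unfolding normal_deriv_def by (rule integral_eq_zero_AE)
  qed
  then have "0 \<in> DA \<Omega>" using zero_H2[OF assms] by (simp add: DA_def)
  then show ?thesis
    unfolding fun_vs.subspace_def plus_fun_def
    using DA_comb[OF assms, of _ _ 1 1] DA_comb[OF assms, of _ _ _ 0] by auto
qed

text \<open>Stated for any carrier whose norm dominates \<open>normH\<close>, so that it serves
  \<open>normV\<close> and \<open>normDA\<close> alike.\<close>

lemma emb_dual:
  assumes X: "fun_vs.subspace X" "X \<subseteq> L2 \<Omega>" and n: "\<And>w. w \<in> X \<Longrightarrow> normH \<Omega> w \<le> n w"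
    and y: "y \<in> L2 \<Omega>"
  shows "emb \<Omega> X y \<in> dual X n" "\<And>w. w \<in> X \<Longrightarrow> \<bar>emb \<Omega> X y w\<bar> \<le> normH \<Omega> y * n w"
proof -
  show bd: "\<bar>emb \<Omega> X y w\<bar> \<le> normH \<Omega> y * n w" if w: "w \<in> X" for w
  proof -
    have "\<bar>ipH \<Omega> y w\<bar> \<le> normH \<Omega> y * normH \<Omega> w"
      using X w y by (intro ipH_Cauchy_Schwarz) auto
    also have "\<dots> \<le> normH \<Omega> y * n w" by (intro mult_left_mono n w normH_nonneg)
    finally show ?thesis using w by (simp add: emb_def restr_def)
  qed
  have "emb \<Omega> X y (u + v) = emb \<Omega> X y u + emb \<Omega> X y v" if "u \<in> X" "v \<in> X" for u v
    using that X y fun_vs.subspace_add[OF X(1) that]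
    by (auto simp: emb_def restr_def plus_fun_def intro!: ipH_add_right)
  moreover have "emb \<Omega> X y (\<lambda>a. c * u a) = c * emb \<Omega> X y u" if "u \<in> X" for u c
    using that fun_vs.subspace_scale[OF X(1) that] by (simp add: emb_def restr_def ipH_scale_right)
  ultimately show "emb \<Omega> X y \<in> dual X n"
    unfolding dual_def using bd
    by (intro CollectI conjI exI[of _ "normH \<Omega> y"]) (auto simp: emb_def restr_def)
qed


subsection \<open>Spectral truncation and the bias\<close>

text \<open>The inverse inherits linearity from \<open>f\<close> on \<open>XN\<close>, so its norm
  is a seminorm there and finite dimension bounds it; this turns the supremum \<open>opnorm\<close>
  into a pointwise bound.\<close>

lemma XN_linear_bounded_inverse:
  fixes \<phi> :: "nat \<Rightarrow> fld"
  assumes nrm: "is_norm_on (XN \<phi> N) n"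
    and ind: "\<forall>c. (\<lambda>x. \<Sum>k=1..N. c k * \<phi> k x) = (\<lambda>x. 0) \<longrightarrow> (\<forall>k\<in>{1..N}. c k = 0)"
    and add: "\<And>u v. u \<in> XN \<phi> N \<Longrightarrow> v \<in> XN \<phi> N \<Longrightarrow> f (u + v) = f u + f v"
    and scl: "\<And>c u. u \<in> XN \<phi> N \<Longrightarrow> f (\<lambda>x. c * u x) = (\<lambda>x. c * f u x)"
    and bij: "bij_betw f (XN \<phi> N) (XN \<phi> N)"
    and y: "y \<in> XN \<phi> N"
  shows "n (the_inv_into (XN \<phi> N) f y)
    \<le> opnorm (XN \<phi> N) n n (the_inv_into (XN \<phi> N) f) * n y"
proof -
  let ?X = "XN \<phi> N" and ?g = "the_inv_into (XN \<phi> N) f"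
  have inj: "inj_on f ?X" and im: "f ` ?X = ?X" using bij by (auto simp: bij_betw_def)
  have g: "?g u \<in> ?X" "f (?g u) = u" if "u \<in> ?X" for u
    using that im the_inv_into_into[OF inj _ order_refl, of u] f_the_inv_into_f[OF inj, of u] by auto
  have gadd: "?g (u + v) = ?g u + ?g v" if "u \<in> ?X" "v \<in> ?X" for u v
    by (rule the_inv_into_f_eq[OF inj])
      (use that g add fun_vs.subspace_add[OF subspace_XN] in auto)
  have gscl: "?g (\<lambda>x. c * u x) = (\<lambda>x. c * ?g u x)" if "u \<in> ?X" for u c
    by (rule the_inv_into_f_eq[OF inj])
      (use that g scl fun_vs.subspace_scale[OF subspace_XN] in auto)
  have "\<exists>C. \<forall>y\<in>?X. n (?g y) \<le> C * n y"
    by (rule seminorm_XN_bounded[OF nrm ind])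
      (use nrm g in \<open>auto simp: is_norm_on_def gadd gscl\<close>)
  then obtain C where "\<And>y. y \<in> ?X \<Longrightarrow> n (?g y) \<le> C * n y" by blast
  then show ?thesis
    by (intro opnorm_bound[of ?X n n ?g C]) (use nrm y in \<open>auto simp: is_norm_on_def\<close>)
qed

text \<open>No series is summed: the lower bound \<open>(1 - q) * n u \<le> n (u + T u)\<close>
  gives injectivity, finite dimension then gives surjectivity, and the same bound read at a preimage
  estimates the inverse.\<close>

lemma XN_contraction_inverse:
  fixes \<phi> :: "nat \<Rightarrow> fld"
  assumes nrm: "is_norm_on (XN \<phi> N) n"
    and add: "\<And>u v. u \<in> XN \<phi> N \<Longrightarrow> v \<in> XN \<phi> N \<Longrightarrow> T (u + v) = T u + T v"
    and scl: "\<And>c u. u \<in> XN \<phi> N \<Longrightarrow> T (\<lambda>x. c * u x) = (\<lambda>x. c * T u x)"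
    and maps: "\<And>u. u \<in> XN \<phi> N \<Longrightarrow> T u \<in> XN \<phi> N"
    and bound: "\<And>u. u \<in> XN \<phi> N \<Longrightarrow> n (T u) \<le> q * n u" and q: "q < 1"
  shows "bij_betw (\<lambda>y. y + T y) (XN \<phi> N) (XN \<phi> N)"
    "opnorm (XN \<phi> N) n n (the_inv_into (XN \<phi> N) (\<lambda>y. y + T y)) \<le> inverse (1 - q)"
proof -
  let ?X = "XN \<phi> N" and ?f = "\<lambda>y. y + T y"
  note sadd = fun_vs.subspace_add[OF subspace_XN[of \<phi> N]]
    and sscl = fun_vs.subspace_scale[OF subspace_XN[of \<phi> N]]
  have n0: "0 \<le> n u" if "u \<in> ?X" for u using nrm that by (auto simp: is_norm_on_def)
  have fX: "?f u \<in> ?X" if "u \<in> ?X" for u using that maps sadd by blast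
  have lower: "(1 - q) * n u \<le> n (?f u)" if u: "u \<in> ?X" for u
  proof -
    \<comment> \<open>Writes \<open>u\<close> as \<open>(u + T u) - T u\<close>; the scalar
      \<open>- 1\<close> fits the homogeneity clause of \<open>is_norm_on\<close>.\<close>
    have "n u = n (?f u + (\<lambda>x. - 1 * T u x))" by (rule arg_cong[of _ _ n]) (simp add: fun_eq_iff)
    also have "\<dots> \<le> n (?f u) + n (\<lambda>x. - 1 * T u x)"
      using nrm fX[OF u] sscl[OF maps[OF u]] unfolding is_norm_on_def by blast
    also have "n (\<lambda>x. - 1 * T u x) = \<bar>- 1\<bar> * n (T u)"
      using nrm maps[OF u] unfolding is_norm_on_def by blast
    finally have "n u \<le> n (u + T u) + n (T u)" by (simp add: plus_fun_def)
    then show ?thesis using bound[OF u] unfolding left_diff_distrib by linarith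
  qed
  have fadd: "?f (u + v) = ?f u + ?f v" if "u \<in> ?X" "v \<in> ?X" for u v
    using add[OF that] by (simp add: algebra_simps)
  have fscl: "?f (\<lambda>x. c * u x) = (\<lambda>x. c * ?f u x)" if "u \<in> ?X" for u c
    using scl[OF that] by (simp add: fun_eq_iff algebra_simps)
  have inj: "inj_on ?f ?X"
  proof (rule inj_onI)
    fix u v assume uv: "u \<in> ?X" "v \<in> ?X" "?f u = ?f v"
    let ?d = "u + (\<lambda>x. - 1 * v x)"
    have d: "?d \<in> ?X" using sadd[OF uv(1) sscl[OF uv(2)]] .
    have "?f ?d = ?f u + (\<lambda>x. - 1 * ?f v x)"
      unfolding fadd[OF uv(1) sscl[OF uv(2)]] fscl[OF uv(2)] ..
    also have "\<dots> = (\<lambda>x. 0 * u x)" unfolding uv(3) by (simp add: fun_eq_iff)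
    finally have "n (?f ?d) = \<bar>0\<bar> * n u" using nrm uv(1) unfolding is_norm_on_def by metis
    then have "n ?d = 0"
      using lower[OF d] n0[OF d] q by (simp add: mult_le_0_iff)
    then have "?d = (\<lambda>x. 0)" using nrm d unfolding is_norm_on_def by blast
    then show "u = v" by (simp add: fun_eq_iff)
  qed
  have "?f ` ?X = ?X"
    by (rule fun_vs.inj_on_span_imp_surj[OF _ XN_eq_span])
      (use fadd fscl fX inj in auto)
  with inj show bij: "bij_betw ?f ?X ?X" by (simp add: bij_betw_def)
  show "opnorm ?X n n (the_inv_into ?X ?f) \<le> inverse (1 - q)"
  proof (rule opnorm_le)
    show "?X \<noteq> {}" using fun_vs.subspace_0[OF subspace_XN] by blast
    show "0 \<le> inverse (1 - q)" using q by simp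
    show "0 \<le> n u" if "u \<in> ?X" for u by (rule n0[OF that])
    fix u assume u: "u \<in> ?X"
    have im: "u \<in> ?f ` ?X" using bij u by (simp add: bij_betw_def)
    have "(1 - q) * n (the_inv_into ?X ?f u) \<le> n u"
      using lower[OF the_inv_into_into[OF inj im order_refl]] f_the_inv_into_f[OF inj im] by simp
    then show "n (the_inv_into ?X ?f u) \<le> inverse (1 - q) * n u"
      using q by (simp add: field_simps)
  qed
qed

section \<open>Eigenmodes and the truncation\<close>

lemma eigenbasis_DA: "eigenbasis \<Omega> \<kappa> \<phi> \<mu> \<Longrightarrow> k \<in> {1..N} \<Longrightarrow> \<phi> k \<in> DA \<Omega>"
  by (simp add: eigenbasis_def)

lemma XN_subset_DA:
  assumes "open \<Omega>" "eigenbasis \<Omega> \<kappa> \<phi> \<mu>"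
  shows "XN \<phi> N \<subseteq> DA \<Omega>"
  unfolding XN_eq_span
  by (rule fun_vs.span_minimal) (use assms subspace_DA eigenbasis_DA in auto)

lemma eigenbasis_coefficient:
  assumes "eigenbasis \<Omega> \<kappa> \<phi> \<mu>" "k \<in> {1..N}"
  shows "ipH \<Omega> (\<lambda>x. \<Sum>j=1..N. c j * \<phi> j x) (\<phi> k) = c k"
proof -
  have "ipH \<Omega> (\<lambda>x. \<Sum>j=1..N. c j * \<phi> j x) (\<phi> k) = (\<Sum>j=1..N. c j * ipH \<Omega> (\<phi> j) (\<phi> k))"
    using assms by (intro ipH_lincomb_left DA_L2) (auto dest: eigenbasis_DA)
  also have "\<dots> = (\<Sum>j=1..N. if j = k then c j else 0)"
    using assms by (intro sum.cong) (auto simp: eigenbasis_def)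
  finally show ?thesis using assms(2) by simp
qed

lemma eigenbasis_independent:
  assumes "eigenbasis \<Omega> \<kappa> \<phi> \<mu>"
  shows "\<forall>c. (\<lambda>x. \<Sum>k=1..N. c k * \<phi> k x) = (\<lambda>x. 0) \<longrightarrow> (\<forall>k\<in>{1..N}. c k = 0)"
proof (intro allI impI ballI)
  fix c k assume "(\<lambda>x. \<Sum>k=1..N. c k * \<phi> k x) = (\<lambda>x. 0)" "k \<in> {1..N}"
  then show "c k = 0"
    using eigenbasis_coefficient[OF assms, of k N c] by (simp add: ipH_def)
qed

lemma PN_XN: "PN \<phi> N \<eta> \<in> XN \<phi> N"
  by (auto simp: PN_def XN_def intro!: exI[of _ "\<lambda>k. \<eta> (\<phi> k)"])

lemma PN_add: "PN \<phi> N (\<eta> + \<zeta>) = PN \<phi> N \<eta> + PN \<phi> N \<zeta>"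
  by (simp add: PN_def fun_eq_iff sum.distrib algebra_simps)

lemma PN_scale: "PN \<phi> N (\<lambda>w. c * \<eta> w) = (\<lambda>x. c * PN \<phi> N \<eta> x)"
  by (simp add: PN_def fun_eq_iff sum_distrib_left mult.assoc)

text \<open>The inclusion of \<open>DA \<Omega>\<close> keeps every \<open>\<phi> k\<close> in the
  carrier, so the embedded \<open>y\<close> takes its true inner products there and not the default
  \<open>0\<close>.\<close>

lemma PN_emb:
  assumes "eigenbasis \<Omega> \<kappa> \<phi> \<mu>" "y \<in> XN \<phi> N" "DA \<Omega> \<subseteq> X"
  shows "PN \<phi> N (emb \<Omega> X y) = y"
proof -
  obtain c where c: "y = (\<lambda>x. \<Sum>k=1..N. c k * \<phi> k x)" using assms(2) by (auto simp: XN_def)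
  have "emb \<Omega> X y (\<phi> k) = c k" if "k \<in> {1..N}" for k
    using eigenbasis_coefficient[OF assms(1) that] eigenbasis_DA[OF assms(1) that] assms(3)
    by (auto simp: emb_def restr_def c)
  then show ?thesis by (simp add: PN_def c)
qed

lemma emb_add:
  assumes "X \<subseteq> L2 \<Omega>" "y \<in> L2 \<Omega>" "z \<in> L2 \<Omega>"
  shows "emb \<Omega> X (y + z) = emb \<Omega> X y + emb \<Omega> X z"
  using assms by (auto simp: emb_def restr_def fun_eq_iff plus_fun_def ipH_add_left)

text \<open>The truncation is a finite sum of rank-one operators, each bounded because evaluation at
  \<open>\<phi> k\<close> and pairing with \<open>\<phi> k\<close> are.\<close>

lemma IPN_bounded:
  fixes \<phi> :: "nat \<Rightarrow> fld"
  assumes X: "fun_vs.subspace X" "X \<subseteq> L2 \<Omega>" and n: "\<And>w. w \<in> X \<Longrightarrow> normH \<Omega> w \<le> n w"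
    and \<phi>: "\<And>k. k \<in> {1..N} \<Longrightarrow> \<phi> k \<in> X"
  shows "\<And>\<eta>. \<eta> \<in> dual X n \<Longrightarrow> IPN \<Omega> X \<phi> N \<eta> \<in> dual X n"
    "\<exists>C\<ge>0. \<forall>\<eta>\<in>dual X n. dual_norm X n (IPN \<Omega> X \<phi> N \<eta>) \<le> C * dual_norm X n \<eta>"
proof -
  have \<phi>L: "\<phi> k \<in> L2 \<Omega>" if "k \<in> {1..N}" for k using X \<phi> that by blast
  have n0: "0 \<le> n w" if "w \<in> X" for w using n[OF that] normH_nonneg[of \<Omega> w] by simp
  show "IPN \<Omega> X \<phi> N \<eta> \<in> dual X n" if "\<eta> \<in> dual X n" for \<eta>
    unfolding IPN_def
    by (intro fun_vs.subspace_diff[OF subspace_dual] that emb_dual X n)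
      (use L2_lincomb[of "{1..N}" \<phi>] \<phi>L in \<open>simp_all add: PN_def\<close>)
  \<comment> \<open>\<open>1\<close> for the identity and, for each mode,
    \<open>n (\<phi> k)\<close> for the evaluation times \<open>normH \<Omega> (\<phi> k)\<close>
    for the embedded mode.\<close>
  define C where "C = 1 + (\<Sum>k=1..N. n (\<phi> k) * normH \<Omega> (\<phi> k))"
  have C: "C \<ge> 0" unfolding C_def
    using n0 \<phi> by (intro add_nonneg_nonneg sum_nonneg mult_nonneg_nonneg normH_nonneg) auto
  moreover have "dual_norm X n (IPN \<Omega> X \<phi> N \<eta>) \<le> C * dual_norm X n \<eta>" if \<eta>: "\<eta> \<in> dual X n" for \<eta>
  proof (rule dual_norm_le)
    show "X \<noteq> {}" using fun_vs.subspace_0[OF X(1)] by blast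
    show "0 \<le> C * dual_norm X n \<eta>"
      using C dual_norm_nonneg[OF \<eta> n0 \<open>X \<noteq> {}\<close>] by simp
    fix w assume w: "w \<in> X"
    have "IPN \<Omega> X \<phi> N \<eta> w = \<eta> w - (\<Sum>k=1..N. \<eta> (\<phi> k) * ipH \<Omega> (\<phi> k) w)"
      using w X \<phi>L by (auto simp: IPN_def emb_def restr_def PN_def intro!: ipH_lincomb_left)
    also have "\<bar>\<dots>\<bar> \<le> \<bar>\<eta> w\<bar> + (\<Sum>k=1..N. \<bar>\<eta> (\<phi> k) * ipH \<Omega> (\<phi> k) w\<bar>)"
      by (rule order_trans[OF abs_triangle_ineq4 add_left_mono[OF sum_abs]])
    also have "\<dots> \<le> dual_norm X n \<eta> * n w
        + (\<Sum>k=1..N. (dual_norm X n \<eta> * n (\<phi> k)) * (normH \<Omega> (\<phi> k) * n w))"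
    proof (intro add_mono sum_mono)
      show "\<bar>\<eta> w\<bar> \<le> dual_norm X n \<eta> * n w" by (rule dual_apply_le[OF \<eta> n0 w])
      fix k assume k: "k \<in> {1..N}"
      have "\<bar>ipH \<Omega> (\<phi> k) w\<bar> \<le> normH \<Omega> (\<phi> k) * n w"
        using emb_dual(2)[OF X n \<phi>L[OF k] w] w by (simp add: emb_def restr_def)
      moreover have "\<bar>\<eta> (\<phi> k)\<bar> \<le> dual_norm X n \<eta> * n (\<phi> k)"
        by (rule dual_apply_le[OF \<eta> n0 \<phi>[OF k]])
      ultimately show "\<bar>\<eta> (\<phi> k) * ipH \<Omega> (\<phi> k) w\<bar>
          \<le> (dual_norm X n \<eta> * n (\<phi> k)) * (normH \<Omega> (\<phi> k) * n w)"
        unfolding abs_mult by (intro mult_mono') auto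
    qed
    also have "\<dots> = C * dual_norm X n \<eta> * n w"
      by (simp add: C_def algebra_simps sum_distrib_left)
    finally show "\<bar>IPN \<Omega> X \<phi> N \<eta> w\<bar> \<le> C * dual_norm X n \<eta> * n w" .
  qed (use n0 in auto)
  ultimately show "\<exists>C\<ge>0. \<forall>\<eta>\<in>dual X n. dual_norm X n (IPN \<Omega> X \<phi> N \<eta>) \<le> C * dual_norm X n \<eta>"
    by blast
qed

text \<open>Continuity of point evaluation enters through the hypothesis \<open>dual\<close>. With
  finitely many actuators, the sum of the dual norms of the Dirac functionals is then a
  bound.\<close>

lemma opB_bounded:
  fixes p :: "'m::finite \<Rightarrow> pt"
  assumes dual: "\<And>u. opB \<Omega> p u \<in> dual (DA \<Omega>) n" and n0: "\<And>w. w \<in> DA \<Omega> \<Longrightarrow> 0 \<le> n w"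
    and ne: "DA \<Omega> \<noteq> {}"
  shows "\<exists>D\<ge>0. \<forall>u. dual_norm (DA \<Omega>) n (opB \<Omega> p u) \<le> D * norm u"
proof -
  let ?e = "\<lambda>j. opB \<Omega> p (axis j 1)"
  define D where "D = (\<Sum>j\<in>UNIV. dual_norm (DA \<Omega>) n (?e j))"
  have N0: "0 \<le> dual_norm (DA \<Omega>) n (?e j)" for j by (rule dual_norm_nonneg[OF dual n0 ne])
  then have D: "D \<ge> 0" unfolding D_def by (rule sum_nonneg)
  have e: "?e j = dirac \<Omega> (p j)" for j
    by (simp add: opB_def axis_def fun_eq_iff if_distrib[of "\<lambda>a. a * _"] cong: if_cong)
  have "dual_norm (DA \<Omega>) n (opB \<Omega> p u) \<le> D * norm u" for u
  proof (rule dual_norm_le[OF ne _ n0])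
    show "0 \<le> D * norm u" using D by simp
    fix w assume w: "w \<in> DA \<Omega>"
    have "\<bar>opB \<Omega> p u w\<bar> \<le> (\<Sum>j\<in>UNIV. \<bar>u $ j * ?e j w\<bar>)"
      unfolding e by (simp add: opB_def sum_abs)
    also have "\<dots> \<le> (\<Sum>j\<in>UNIV. norm u * (dual_norm (DA \<Omega>) n (?e j) * n w))"
      unfolding abs_mult
      by (intro sum_mono mult_mono component_le_norm_cart dual_apply_le[OF dual n0 w]) auto
    also have "\<dots> = D * norm u * n w" by (simp add: D_def sum_distrib_left sum_distrib_right mult_ac)
    finally show "\<bar>opB \<Omega> p u w\<bar> \<le> D * norm u * n w" .
  qed
  then show ?thesis using D by blast
qed

text \<open>The feedforward cancels the modes of \<open>A\<^sub>0 y\<close>, which all lie below \<open>N\<close>.\<close>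

lemma residual_eq_IPN:
  assumes "open \<Omega>" and eig: "eigenbasis \<Omega> \<kappa> \<phi> \<mu>" and ff: "low_mode_feedforward \<Omega> \<kappa> \<phi> N p U"
    and y: "y \<in> XN \<phi> N"
  shows "residual \<Omega> \<kappa> p U y = IPN \<Omega> (DA \<Omega>) \<phi> N (opB \<Omega> p (U y))"
proof
  fix w
  obtain c where c: "y = (\<lambda>x. \<Sum>k=1..N. c k * \<phi> k x)" using y by (auto simp: XN_def)
  have yD: "y \<in> DA \<Omega>" using y XN_subset_DA[OF assms(1) eig] by blast
  \<comment> \<open>The eigenvalue equation holds almost everywhere, so it is used only under a
    pairing with an L2 function.\<close>
  have eigen: "ipH \<Omega> (A0 \<Omega> \<kappa> (\<phi> k)) f = - \<mu> k * ipH \<Omega> (\<phi> k) f" if "k \<in> {1..N}" "f \<in> L2 \<Omega>" for k f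
  proof -
    note k = eigenbasis_DA[OF eig that(1)]
    have "AE x in lebesgue_on \<Omega>. - A0 \<Omega> \<kappa> (\<phi> k) x = \<mu> k * \<phi> k x"
      using eig that(1) by (simp add: eigenbasis_def)
    then have "AE x in lebesgue_on \<Omega>. A0 \<Omega> \<kappa> (\<phi> k) x = - \<mu> k * \<phi> k x"
      by eventually_elim simp
    then have "ipH \<Omega> (A0 \<Omega> \<kappa> (\<phi> k)) f = ipH \<Omega> (\<lambda>x. - \<mu> k * \<phi> k x) f"
      by (intro ipH_cong_AE A0_L2 L2_scale DA_L2 k that)
    then show ?thesis by (simp only: ipH_scale_left)
  qed
  have B: "opB \<Omega> p (U y) (\<phi> k) = \<mu> k * c k" if k: "k \<in> {1..N}" for k
  proof -
    note kD = eigenbasis_DA[OF eig k]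
    have "opB \<Omega> p (U y) (\<phi> k) = - ipH \<Omega> (A0 \<Omega> \<kappa> y) (\<phi> k)"
      using ff y k kD by (simp add: low_mode_feedforward_def opB_def dirac_def restr_def)
    \<comment> \<open>Symmetry moves \<open>A0\<close> from the combination \<open>y\<close> onto a
      single eigenfunction.\<close>
    also have "ipH \<Omega> (A0 \<Omega> \<kappa> y) (\<phi> k) = ipH \<Omega> (A0 \<Omega> \<kappa> (\<phi> k)) y"
      using A0_symmetric[OF yD kD] by (simp add: ipH_commute)
    also have "\<dots> = - \<mu> k * c k"
      unfolding eigen[OF k DA_L2[OF yD]] using eigenbasis_coefficient[OF eig k]
      by (simp add: c ipH_commute)
    finally show ?thesis by simp
  qed
  show "residual \<Omega> \<kappa> p U y w = IPN \<Omega> (DA \<Omega>) \<phi> N (opB \<Omega> p (U y)) w"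
  proof (cases "w \<in> DA \<Omega>")
    case True
    \<comment> \<open>This pairing is the value of the extended \<open>A0 y\<close> at
      \<open>w\<close>; moving \<open>A0\<close> onto the modes shows that it is minus the truncated
      part of \<open>B U y\<close>.\<close>
    have "ipH \<Omega> y (A0 \<Omega> \<kappa> w) = (\<Sum>k=1..N. c k * ipH \<Omega> (\<phi> k) (A0 \<Omega> \<kappa> w))"
      unfolding c by (intro ipH_lincomb_left A0_L2 True DA_L2 eigenbasis_DA[OF eig])
    also have "\<dots> = (\<Sum>k=1..N. c k * (- \<mu> k * ipH \<Omega> (\<phi> k) w))"
    proof (intro sum.cong refl)
      fix k assume k: "k \<in> {1..N}"
      show "c k * ipH \<Omega> (\<phi> k) (A0 \<Omega> \<kappa> w) = c k * (- \<mu> k * ipH \<Omega> (\<phi> k) w)"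
        using A0_symmetric[OF eigenbasis_DA[OF eig k] True, of \<kappa>] eigen[OF k DA_L2[OF True]] by simp
    qed
    also have "\<dots> = - (\<Sum>k=1..N. opB \<Omega> p (U y) (\<phi> k) * ipH \<Omega> (\<phi> k) w)"
      using B by (simp add: sum_negf[symmetric] mult_ac)
    also have "(\<Sum>k=1..N. opB \<Omega> p (U y) (\<phi> k) * ipH \<Omega> (\<phi> k) w) = ipH \<Omega> (PN \<phi> N (opB \<Omega> p (U y))) w"
      unfolding PN_def
      by (intro ipH_lincomb_left[symmetric] DA_L2[OF True] DA_L2 eigenbasis_DA[OF eig])
    finally show ?thesis
      using True by (simp add: residual_def IPN_def A0_ext_def emb_def restr_def)
  next
    case False
    then show ?thesis by (simp add: residual_def IPN_def A0_ext_def emb_def restr_def)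
  qed
qed

theorem corollary5p9:
  fixes \<Omega> :: "(real^3) set" and \<kappa> :: real
    and \<phi> :: "nat \<Rightarrow> real^3 \<Rightarrow> real" and \<mu> :: "nat \<Rightarrow> real" and N :: nat
    and normX :: "(real^3 \<Rightarrow> real) \<Rightarrow> real"
    and p :: "'m::finite \<Rightarrow> real^3" and U :: "(real^3 \<Rightarrow> real) \<Rightarrow> real^'m"
    and lam :: real
    and S S' :: "real \<Rightarrow> ((real^3 \<Rightarrow> real) \<Rightarrow> real) \<Rightarrow> ((real^3 \<Rightarrow> real) \<Rightarrow> real)"
    and R :: "((real^3 \<Rightarrow> real) \<Rightarrow> real) \<Rightarrow> ((real^3 \<Rightarrow> real) \<Rightarrow> real)"
    and Ccl :: real
    and yr ystar :: "real^3 \<Rightarrow> real"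
  assumes "bounded_C2_domain \<Omega>" and "\<kappa> > 0"
    and "eigenbasis \<Omega> \<kappa> \<phi> \<mu>"
    and "is_norm_on (XN \<phi> N) normX"
    and "\<forall>j. p j \<in> \<Omega>"
    and "\<forall>u. opB \<Omega> p u \<in> DAd \<Omega> \<kappa>"
    and "full_row_rank \<Omega> \<phi> N p"
    and "low_mode_feedforward \<Omega> \<kappa> \<phi> N p U"
    and "lam > 0"
    and "c0_semigroup (Vd \<Omega> \<kappa>) (normVd \<Omega> \<kappa>) S"
    and "has_generator (Vd \<Omega> \<kappa>) (normVd \<Omega> \<kappa>) S (closed_loop_graph \<Omega> \<kappa> p lam)"
    and "exponentially_stable (Vd \<Omega> \<kappa>) (normVd \<Omega> \<kappa>) S"
    and "extends_to_DAd \<Omega> \<kappa> S S'"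
    and "semigroup_integral \<Omega> \<kappa> S' R"
    and "bounded_operator (DAd \<Omega> \<kappa>) (normDAd \<Omega> \<kappa>) (Vd \<Omega> \<kappa>) (normVd \<Omega> \<kappa>) R"
    and "Ccl > 0"
    and "\<forall>h\<in>DAd \<Omega> \<kappa>. normVd \<Omega> \<kappa> (R h) \<le> Ccl * normDAd \<Omega> \<kappa> h"
  defines "Z \<equiv> \<lambda>y. R (residual \<Omega> \<kappa> p U y)"
  defines "T \<equiv> \<lambda>y. PN \<phi> N (Z y)"
  defines "yinf \<equiv> \<lambda>y. emb \<Omega> (H1 \<Omega>) y + Z y"
  defines "ImPV \<equiv> IPN \<Omega> (H1 \<Omega>) \<phi> N"
  defines "nImPV \<equiv> opnorm (Vd \<Omega> \<kappa>) (normVd \<Omega> \<kappa>) (normVd \<Omega> \<kappa>) ImPV"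
  defines "nImPB \<equiv> opnorm UNIV norm (normDAd \<Omega> \<kappa>) (\<lambda>u. IPN \<Omega> (DA \<Omega>) \<phi> N (opB \<Omega> p u))"
  defines "nU \<equiv> opnorm (XN \<phi> N) normX norm U"
  defines "nT \<equiv> opnorm (XN \<phi> N) normX normX T"
  defines "IT \<equiv> \<lambda>y. y + T y"
  defines "ITinv \<equiv> the_inv_into (XN \<phi> N) IT"
  defines "nITinv \<equiv> opnorm (XN \<phi> N) normX normX ITinv"
  assumes "yr \<in> XN \<phi> N" and "ystar \<in> XN \<phi> N" and "ystar + T ystar = yr"
  shows "yinf ystar \<in> Vd \<Omega> \<kappa>
    \<and> PN \<phi> N (yinf ystar) = yr
    \<and> yinf ystar - emb \<Omega> (H1 \<Omega>) yr = ImPV (yinf ystar)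
    \<and> ImPV (yinf ystar) = ImPV (Z ystar)
    \<and> normVd \<Omega> \<kappa> (yinf ystar - emb \<Omega> (H1 \<Omega>) yr) \<le> nImPV * Ccl * nImPB * nU * normX ystar
    \<and> (bij_betw IT (XN \<phi> N) (XN \<phi> N) \<longrightarrow>
         ystar = ITinv yr \<and>
         normVd \<Omega> \<kappa> (yinf ystar - emb \<Omega> (H1 \<Omega>) yr)
           \<le> nImPV * Ccl * nImPB * nU * nITinv * normX yr)
    \<and> (nT < 1 \<longrightarrow> bij_betw IT (XN \<phi> N) (XN \<phi> N) \<and> nITinv \<le> inverse (1 - nT))"
proof -
  let ?X = "XN \<phi> N"
  let ?nV = "normV \<Omega> \<kappa>" and ?nD = "normDA \<Omega> \<kappa>"
  note eig = \<open>eigenbasis \<Omega> \<kappa> \<phi> \<mu>\<close> and nrm = \<open>is_norm_on ?X normX\<close>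
    and ff = \<open>low_mode_feedforward \<Omega> \<kappa> \<phi> N p U\<close>
  have "open \<Omega>" using \<open>bounded_C2_domain \<Omega>\<close> by (simp add: bounded_C2_domain_def)
  note sX = subspace_XN[of \<phi> N] and sV = subspace_H1[OF \<open>open \<Omega>\<close>] and sD = subspace_DA[OF \<open>open \<Omega>\<close>]
  have VL: "H1 \<Omega> \<subseteq> L2 \<Omega>" and DL: "DA \<Omega> \<subseteq> L2 \<Omega>" and DV: "DA \<Omega> \<subseteq> H1 \<Omega>"
    by (auto simp: H1_L2 DA_L2 DA_H1)
  have XD: "?X \<subseteq> DA \<Omega>" by (rule XN_subset_DA[OF \<open>open \<Omega>\<close> eig])
  have XL: "?X \<subseteq> L2 \<Omega>" using XD DL by blast
  have nV: "normH \<Omega> w \<le> ?nV w" for w by (rule normH_le_normV[OF \<open>\<kappa> > 0\<close>])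
  have nV0: "0 \<le> ?nV w" for w using nV[of w] normH_nonneg[of \<Omega> w] by simp
  have nD: "normH \<Omega> w \<le> ?nD w" if "w \<in> DA \<Omega>" for w by (rule normH_le_normDA[OF that \<open>\<kappa> > 0\<close>])
  have nD0: "0 \<le> ?nD w" for w by (simp add: normDA_def normH_nonneg)
  have neX: "?X \<noteq> {}" and neV: "H1 \<Omega> \<noteq> {}" and neD: "DA \<Omega> \<noteq> {}"
    using fun_vs.subspace_0[OF sX] fun_vs.subspace_0[OF sV] fun_vs.subspace_0[OF sD] by blast+
  have nX0: "0 \<le> normX u" if "u \<in> ?X" for u using nrm that by (auto simp: is_norm_on_def)
  note ind = eigenbasis_independent[OF eig, of N]
  note \<phi>D = eigenbasis_DA[OF eig, of _ N]
  have \<phi>V: "\<phi> k \<in> H1 \<Omega>" if "k \<in> {1..N}" for k using \<phi>D[OF that] DV by blast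

  \<comment> \<open>Both instances are needed: the projection acts on \<open>V'\<close> in the error
    and on \<open>D(A)'\<close> in the residual.\<close>
  have IPN_V: "\<And>\<eta>. \<eta> \<in> dual (H1 \<Omega>) ?nV \<Longrightarrow> IPN \<Omega> (H1 \<Omega>) \<phi> N \<eta> \<in> dual (H1 \<Omega>) ?nV"
    "\<exists>C\<ge>0. \<forall>\<eta>\<in>dual (H1 \<Omega>) ?nV. dual_norm (H1 \<Omega>) ?nV (IPN \<Omega> (H1 \<Omega>) \<phi> N \<eta>) \<le> C * dual_norm (H1 \<Omega>) ?nV \<eta>"
    by (rule IPN_bounded[OF sV VL nV]; (rule \<phi>V)?; assumption)+
  have IPN_D: "\<And>\<eta>. \<eta> \<in> dual (DA \<Omega>) ?nD \<Longrightarrow> IPN \<Omega> (DA \<Omega>) \<phi> N \<eta> \<in> dual (DA \<Omega>) ?nD"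
    "\<exists>C\<ge>0. \<forall>\<eta>\<in>dual (DA \<Omega>) ?nD. dual_norm (DA \<Omega>) ?nD (IPN \<Omega> (DA \<Omega>) \<phi> N \<eta>) \<le> C * dual_norm (DA \<Omega>) ?nD \<eta>"
    by (rule IPN_bounded[OF sD DL]; (rule nD \<phi>D)?; assumption)+
  have BD: "opB \<Omega> p u \<in> dual (DA \<Omega>) ?nD" for u using assms(6) by (simp add: DAd_def)
  have resid: "residual \<Omega> \<kappa> p U y = IPN \<Omega> (DA \<Omega>) \<phi> N (opB \<Omega> p (U y))" if "y \<in> ?X" for y
    by (rule residual_eq_IPN[OF \<open>open \<Omega>\<close> eig ff that])
  have residD: "residual \<Omega> \<kappa> p U y \<in> DAd \<Omega> \<kappa>" if "y \<in> ?X" for y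
    unfolding resid[OF that] DAd_def by (rule IPN_D(1)[OF BD])
  have ZV: "Z y \<in> Vd \<Omega> \<kappa>" if "y \<in> ?X" for y
    using assms(15) residD[OF that] by (simp add: Z_def bounded_operator_def)

  have Uadd: "U (y + z) = U y + U z" if "y \<in> ?X" "z \<in> ?X" for y z
    using ff that by (simp add: low_mode_feedforward_def)
  have Uscl: "U (\<lambda>x. c * y x) = c *\<^sub>R U y" if "y \<in> ?X" for c y
    using ff that by (simp add: low_mode_feedforward_def)
  \<comment> \<open>Additivity is exact, because \<open>A0_ext\<close> pairs its argument with
    \<open>A0 \<Omega> \<kappa> w\<close> for a fixed \<open>w\<close>, so no gradient of
    \<open>y + z\<close> is chosen.\<close>
  have "residual \<Omega> \<kappa> p U (y + z) = residual \<Omega> \<kappa> p U y + residual \<Omega> \<kappa> p U z" if "y \<in> ?X" "z \<in> ?X" for y z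
    using that XL Uadd[OF that]
    by (auto simp: residual_def A0_ext_def opB_def restr_def fun_eq_iff plus_fun_def subset_iff
        ipH_add_left A0_L2 sum.distrib algebra_simps)
  then have Zadd: "Z (y + z) = Z y + Z z" if "y \<in> ?X" "z \<in> ?X" for y z
    using assms(15) residD that unfolding Z_def bounded_operator_def by simp
  have "residual \<Omega> \<kappa> p U (\<lambda>x. c * y x) = (\<lambda>w. c * residual \<Omega> \<kappa> p U y w)" if "y \<in> ?X" for c y
    using Uscl[OF that]
    by (auto simp: residual_def A0_ext_def opB_def restr_def fun_eq_iff
        ipH_scale_left sum_distrib_left algebra_simps)
  then have Zscl: "Z (\<lambda>x. c * y x) = (\<lambda>w. c * Z y w)" if "y \<in> ?X" for c y
    using assms(15) residD that unfolding Z_def bounded_operator_def by simp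
  have TX: "T y \<in> ?X" for y unfolding T_def by (rule PN_XN)
  have Tadd: "T (y + z) = T y + T z" if "y \<in> ?X" "z \<in> ?X" for y z
    unfolding T_def Zadd[OF that] by (rule PN_add)
  have Tscl: "T (\<lambda>x. c * y x) = (\<lambda>x. c * T y x)" if "y \<in> ?X" for c y
    unfolding T_def Zscl[OF that] by (rule PN_scale)

  have Tbound: "normX (T y) \<le> nT * normX y" if y: "y \<in> ?X" for y
  proof -
    have "\<exists>C. \<forall>y\<in>?X. normX (T y) \<le> C * normX y"
      by (rule seminorm_XN_bounded[OF nrm ind])
        (use nrm TX in \<open>auto simp: is_norm_on_def Tadd Tscl\<close>)
    then obtain C where "\<And>y. y \<in> ?X \<Longrightarrow> normX (T y) \<le> C * normX y" by blast
    then show ?thesis unfolding nT_def using nX0 y by (intro opnorm_bound[of ?X normX normX T C])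
  qed
  obtain CU where CU: "\<And>y. y \<in> ?X \<Longrightarrow> norm (U y) \<le> CU * normX y"
  proof -
    have "\<exists>C. \<forall>y\<in>?X. norm (U y) \<le> C * normX y"
      by (rule seminorm_XN_bounded[OF nrm ind]) (simp_all add: Uadd Uscl norm_triangle_ineq)
    then show ?thesis using that by blast
  qed
  have Ubound: "norm (U y) \<le> nU * normX y" if "y \<in> ?X" for y
    unfolding nU_def using CU nX0 that by (intro opnorm_bound[of ?X normX norm U CU])
  have nU0: "0 \<le> nU"
    unfolding nU_def using CU nX0 neX by (intro opnorm_nonneg[of ?X normX norm U CU]) auto

  obtain CV where CV: "\<And>\<eta>. \<eta> \<in> Vd \<Omega> \<kappa> \<Longrightarrow> normVd \<Omega> \<kappa> (ImPV \<eta>) \<le> CV * normVd \<Omega> \<kappa> \<eta>"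
    using IPN_V(2) unfolding Vd_def normVd_def ImPV_def by blast
  have nVd0: "0 \<le> normVd \<Omega> \<kappa> \<eta>" if "\<eta> \<in> Vd \<Omega> \<kappa>" for \<eta>
    using dual_norm_nonneg[OF that[unfolded Vd_def] nV0 neV] by (simp add: normVd_def)
  have ImPV_V: "ImPV \<eta> \<in> Vd \<Omega> \<kappa>" if "\<eta> \<in> Vd \<Omega> \<kappa>" for \<eta>
    using IPN_V(1) that unfolding Vd_def ImPV_def by blast
  have Vbound: "normVd \<Omega> \<kappa> (ImPV \<eta>) \<le> nImPV * normVd \<Omega> \<kappa> \<eta>" if "\<eta> \<in> Vd \<Omega> \<kappa>" for \<eta>
    unfolding nImPV_def using CV nVd0 that
    by (intro opnorm_bound[of "Vd \<Omega> \<kappa>" "normVd \<Omega> \<kappa>" "normVd \<Omega> \<kappa>" ImPV CV])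
  have "Vd \<Omega> \<kappa> \<noteq> {}" using ZV neX by blast
  then have nImPV0: "0 \<le> nImPV"
    unfolding nImPV_def using CV nVd0 ImPV_V
    by (intro opnorm_nonneg[of "Vd \<Omega> \<kappa>" "normVd \<Omega> \<kappa>" "normVd \<Omega> \<kappa>" ImPV CV]) auto

  let ?IB = "\<lambda>u. IPN \<Omega> (DA \<Omega>) \<phi> N (opB \<Omega> p u)"
  \<comment> \<open>A crude constant, the product of those of the two factors; it secures a finite
    supremum, and the estimate then uses \<open>nImPB\<close> itself.\<close>
  obtain CB where CB: "\<And>u. normDAd \<Omega> \<kappa> (?IB u) \<le> CB * norm u"
  proof -
    obtain C where C: "C \<ge> 0" "\<And>\<eta>. \<eta> \<in> dual (DA \<Omega>) ?nD \<Longrightarrow>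
        dual_norm (DA \<Omega>) ?nD (IPN \<Omega> (DA \<Omega>) \<phi> N \<eta>) \<le> C * dual_norm (DA \<Omega>) ?nD \<eta>"
      using IPN_D(2) by blast
    obtain D where D: "\<And>u. dual_norm (DA \<Omega>) ?nD (opB \<Omega> p u) \<le> D * norm u"
      using opB_bounded[OF BD nD0 neD] by blast
    have "normDAd \<Omega> \<kappa> (?IB u) \<le> (C * D) * norm u" for u
      using order_trans[OF C(2)[OF BD] mult_left_mono[OF D C(1)], of u]
      by (simp add: normDAd_def mult.assoc)
    then show ?thesis by (rule that)
  qed
  have Bbound: "normDAd \<Omega> \<kappa> (?IB u) \<le> nImPB * norm u" for u
    unfolding nImPB_def using CB by (intro opnorm_bound[of UNIV norm "normDAd \<Omega> \<kappa>" ?IB CB]) auto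
  have nImPB0: "0 \<le> nImPB"
    unfolding nImPB_def
  proof (rule opnorm_nonneg[of UNIV norm "normDAd \<Omega> \<kappa>" ?IB CB])
    show "0 \<le> normDAd \<Omega> \<kappa> (?IB u)" for u
      unfolding normDAd_def by (rule dual_norm_nonneg[OF IPN_D(1)[OF BD] nD0 neD])
  qed (use CB in auto)

  note y = \<open>ystar \<in> ?X\<close> and yr = \<open>yr \<in> ?X\<close> and fixpt = \<open>ystar + T ystar = yr\<close>
  have embV: "emb \<Omega> (H1 \<Omega>) ystar \<in> Vd \<Omega> \<kappa>"
    unfolding Vd_def using y XL by (intro emb_dual(1) sV VL nV) auto
  have c1: "yinf ystar \<in> Vd \<Omega> \<kappa>"
    unfolding yinf_def using fun_vs.subspace_add[OF subspace_dual] embV ZV[OF y] by (simp add: Vd_def)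
  \<comment> \<open>The truncation returns \<open>ystar\<close> from its embedding and
    \<open>T ystar\<close> from the bias; the fixed-point equation adds them up to
    \<open>yr\<close>.\<close>
  have c2: "PN \<phi> N (yinf ystar) = yr"
    unfolding yinf_def PN_add PN_emb[OF eig y DV] using fixpt by (simp add: T_def)
  have c3: "yinf ystar - emb \<Omega> (H1 \<Omega>) yr = ImPV (yinf ystar)"
    unfolding ImPV_def IPN_def c2 ..
  have "emb \<Omega> (H1 \<Omega>) yr = emb \<Omega> (H1 \<Omega>) ystar + emb \<Omega> (H1 \<Omega>) (T ystar)"
    unfolding fixpt[symmetric] using y TX XL by (intro emb_add VL) auto
  \<comment> \<open>The target is \<open>ystar + T ystar\<close>, so the embedded
    \<open>ystar\<close> cancels and the bias minus its own truncation remains.\<close>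
  then have c4: "ImPV (yinf ystar) = ImPV (Z ystar)"
    unfolding c3[symmetric] unfolding ImPV_def IPN_def by (simp add: yinf_def T_def fun_eq_iff)
  \<comment> \<open>The factors are peeled off from the outside: the projection on
    \<open>V'\<close>, then \<open>R\<close>, then \<open>(I - P_N) B\<close> by the residual
    identity, then \<open>U\<close>.\<close>
  have "normVd \<Omega> \<kappa> (ImPV (Z ystar)) \<le> nImPV * normVd \<Omega> \<kappa> (Z ystar)"
    by (rule Vbound[OF ZV[OF y]])
  also have "\<dots> \<le> nImPV * (Ccl * normDAd \<Omega> \<kappa> (residual \<Omega> \<kappa> p U ystar))"
    unfolding Z_def using assms(17) residD[OF y] nImPV0 by (intro mult_left_mono) auto
  also have "\<dots> \<le> nImPV * (Ccl * (nImPB * norm (U ystar)))"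
    unfolding resid[OF y] using \<open>Ccl > 0\<close> nImPV0 by (intro mult_left_mono Bbound) auto
  also have "\<dots> \<le> nImPV * (Ccl * (nImPB * (nU * normX ystar)))"
    using \<open>Ccl > 0\<close> nImPV0 nImPB0 by (intro mult_left_mono Ubound y) auto
  finally have c5: "normVd \<Omega> \<kappa> (yinf ystar - emb \<Omega> (H1 \<Omega>) yr)
      \<le> nImPV * Ccl * nImPB * nU * normX ystar"
    unfolding c3 c4 by (simp add: mult.assoc)
  have c6: "ystar = ITinv yr \<and> normVd \<Omega> \<kappa> (yinf ystar - emb \<Omega> (H1 \<Omega>) yr)
      \<le> nImPV * Ccl * nImPB * nU * nITinv * normX yr" if bij: "bij_betw IT ?X ?X"
  proof -
    have yI: "ystar = ITinv yr"
      using the_inv_into_f_f[of IT ?X ystar] bij y fixpt by (simp add: ITinv_def IT_def bij_betw_def)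
    have "normX ystar \<le> nITinv * normX yr"
      unfolding yI nITinv_def ITinv_def
    proof (rule XN_linear_bounded_inverse[OF nrm ind _ _ bij yr])
      show "IT (u + v) = IT u + IT v" if "u \<in> ?X" "v \<in> ?X" for u v
        using Tadd[OF that] by (simp add: IT_def algebra_simps)
      show "IT (\<lambda>x. c * u x) = (\<lambda>x. c * IT u x)" if "u \<in> ?X" for c u
        using Tscl[OF that] by (simp add: IT_def fun_eq_iff algebra_simps)
    qed
    then have "nImPV * Ccl * nImPB * nU * normX ystar \<le> nImPV * Ccl * nImPB * nU * (nITinv * normX yr)"
      using \<open>Ccl > 0\<close> nImPV0 nImPB0 nU0 by (intro mult_left_mono) auto
    then show ?thesis using yI c5 by (simp add: mult.assoc)
  qed
  \<comment> \<open>The contraction lemma with \<open>q = nT\<close>, an admissible constant by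
    \<open>Tbound\<close>.\<close>
  have c7: "bij_betw IT ?X ?X \<and> nITinv \<le> inverse (1 - nT)" if "nT < 1"
    unfolding nITinv_def ITinv_def IT_def
    using XN_contraction_inverse[OF nrm Tadd Tscl TX Tbound that] by blast
  show ?thesis using c1 c2 c3 c4 c5 c6 c7 by blast
qed

end
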